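(* The triple $\check{\mathbb M}=(\check M,\check\eta_M,\check\mu_M)$ is a monad in the category of Tychonoff spaces and continuous maps. Here for a Tychonoff space $X$, $\check MX$ is the space of all $\tau$-smooth capacities on $X$; for a continuous map $f:X\to Y$ of Tychonoff spaces, $\check Mf(c)(F)=c(f^{-1}(F))$ for $c\in\check MX$ and $F\subset Y$ closed; and the unit and multiplication are given, for closed $F\subset X$, by $$\check\eta_MX(x)(F)=\begin{cases}1,&x\in F,\\0,&x\notin F,\end{cases}\quad x\in X,$$ $$\check\mu_MX(C)(F)=\sup\{\alpha\wedge C(\{c\in\check MX\mid c(F)\ge\alpha\})\mid\alpha\in I\},\quad C\in\check M(\check MX).$$
   Context: $I=[0,1]$, and $\wedge$ denotes minimum. A Tychonoff space is a completely regular Hausdorff space; a compactum is a compact Hausdorff space; $\exp X$ is the set of all non-empty closed subsets of $X$. A ($\tau$-smooth) capacity on a Tychonoff space $X$ is a function $c:\exp X\cup\{\varnothing\}\to I$ such that $c(\varnothing)=0$, $c(X)=1$; $F\subset G$ implies $c(F)\le c(G)$; and for each monotonically decreasing net $(F_\alpha)$ of closed sets in $X$ and each closed $G\subset X$ with $\bigcap_\alpha F_\alpha\subset G$, one has $\inf_\alpha c(F_\alpha)\le c(G)$. The set of all such capacities is $\check MX$. For a compactum $K$, $MK$ is the set of all capacities on $K$: functions $c:\exp K\cup\{\varnothing\}\to I$ with $c(\varnothing)=0$, $c(K)=1$, monotone, and upper semicontinuous (if $c(F)<a$ then there is an open $U\supset F$ with $c(G)<a$ for all closed $G\subset U$). On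 compacta these coincide with $\tau$-smooth capacities, so $MK=\check MK$. $MK$ carries the compact Hausdorff topology with the subbase of all sets $\{c\in MK\mid c(F)<a\}$, $F\subset K$ closed, and $\{c\in MK\mid\text{there is a compact }F\subset U\text{ with } c(F)>a\}$, $U\subset K$ open, $a\in\mathbb R$. For Tychonoff $X$ with Stone–Čech compactification $\beta X\supset X$, the map $e_MX:\check MX\to M\beta X$, $e_MX(c)(F)=c(F\cap X)$ for closed $F\subset\beta X$, is injective, and $\check MX$ is given the topology making $e_MX$ a topological embedding; $\check MX$ is then Tychonoff, so $\check M$ can be applied to it. A monad in a category $\mathcal C$ is a triple $(F,\eta,\mu)$ with $F:\mathcal C\to\mathcal C$ a functor and $\eta:\mathbf 1_{\mathcal C}\to F$, $\mu:F^2\to F$ natural transformations such that $\mu X\circ\eta FX=\mu X\circ F\eta X=\mathbf 1_{FX}$ and $\mu X\circ F\mu X=\mu X\circ\mu FX$ for all objects $X$. *)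

theory Defs
  imports "HOL-Analysis.Analysis"
begin

definition tychonoff_space :: "'a topology \<Rightarrow> bool" where
  "tychonoff_space X \<longleftrightarrow> completely_regular_space X \<and> Hausdorff_space X"

definition decreasing_closed_net ::
    "'a topology \<Rightarrow> 'i set \<Rightarrow> ('i \<times> 'i) set \<Rightarrow> ('i \<Rightarrow> 'a set) \<Rightarrow> bool" where
  "decreasing_closed_net X A r F \<longleftrightarrow>
     A \<noteq> {} \<and> preorder_on A r \<and>
     (\<forall>\<alpha>\<in>A. \<forall>\<beta>\<in>A. \<exists>\<gamma>\<in>A. (\<alpha>, \<gamma>) \<in> r \<and> (\<beta>, \<gamma>) \<in> r) \<and>
     (\<forall>\<alpha>\<in>A. closedin X (F \<alpha>)) \<and>
     (\<forall>\<alpha> \<beta>. (\<alpha>, \<beta>) \<in> r \<longrightarrow> F \<beta> \<subseteq> F \<alpha>)"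

text \<open>A capacity is a function on the closed subsets of the space; as a HOL function on all
  sets it is made extensional (hence the \<open>PiE\<close>), so that equality of capacities is HOL equality.
  HOL cannot quantify over the type of net indices inside a definition. Indices of type
  \<^typ>\<open>'a set\<close> suffice: lemma \<open>tau_capacity_net\<close> below gives \<open>\<tau>\<close>-smoothness for nets with
  indices of an arbitrary type.\<close>

definition tau_capacities :: "'a topology \<Rightarrow> ('a set \<Rightarrow> real) set" where
  "tau_capacities X = {c \<in> Collect (closedin X) \<rightarrow>\<^sub>E {0..1}.
     c {} = 0 \<and> c (topspace X) = 1 \<and>
     (\<forall>F G. closedin X F \<and> closedin X G \<and> F \<subseteq> G \<longrightarrow> c F \<le> c G) \<and>
     (\<forall>(A :: 'a set set) r F G.
        decreasing_closed_net X A r F \<and> closedin X G \<and> (\<Inter>\<alpha>\<in>A. F \<alpha>) \<subseteq> G \<longrightarrow>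
        (INF \<alpha>\<in>A. c (F \<alpha>)) \<le> c G)}"

lemma tau_capacity_net:
  fixes X :: "'a topology" and A :: "'i set"
  assumes "c \<in> tau_capacities X" "decreasing_closed_net X A r F"
    and "closedin X G" "(\<Inter>\<alpha>\<in>A. F \<alpha>) \<subseteq> G"
  shows "(INF \<alpha>\<in>A. c (F \<alpha>)) \<le> c G"
proof -
  define s where "s = {(S, T). S \<in> F ` A \<and> T \<in> F ` A \<and> T \<subseteq> S}"
  have 0: "A \<noteq> {}" "\<forall>\<alpha>\<in>A. \<forall>\<beta>\<in>A. \<exists>\<gamma>\<in>A. (\<alpha>, \<gamma>) \<in> r \<and> (\<beta>, \<gamma>) \<in> r"
     "\<forall>\<alpha>\<in>A. closedin X (F \<alpha>)" "\<forall>\<alpha> \<beta>. (\<alpha>, \<beta>) \<in> r \<longrightarrow> F \<beta> \<subseteq> F \<alpha>"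
    using assms(2) by (auto simp: decreasing_closed_net_def)
  have 1: "preorder_on (F ` A) s"
    by (auto simp: preorder_on_def s_def refl_on_def intro!: transI)
  have 2: "\<exists>\<gamma>\<in>F ` A. (S, \<gamma>) \<in> s \<and> (T, \<gamma>) \<in> s" if ST: "S \<in> F ` A" "T \<in> F ` A" for S T
  proof -
    obtain a b where ab: "a \<in> A" "b \<in> A" "S = F a" "T = F b" using ST by blast
    then obtain g where "g \<in> A" "(a, g) \<in> r" "(b, g) \<in> r" using 0(2) by blast
    then have "F g \<in> F ` A" "F g \<subseteq> S" "F g \<subseteq> T" using 0(4) ab by auto
    then show ?thesis using ST by (auto simp: s_def)
  qed
  have "decreasing_closed_net X (F ` A) s id"
    unfolding decreasing_closed_net_def
  proof (intro conjI)
    show "\<forall>\<alpha>\<in>F ` A. \<forall>\<beta>\<in>F ` A. \<exists>\<gamma>\<in>F ` A. (\<alpha>, \<gamma>) \<in> s \<and> (\<beta>, \<gamma>) \<in> s"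
      using 2 by blast
  qed (use 0(1,3) 1 in \<open>auto simp: s_def\<close>)
  moreover have "(\<Inter>\<alpha>\<in>F ` A. id \<alpha>) \<subseteq> G" using assms(4) by simp
  moreover have "\<forall>(B :: 'a set set) r H G.
        decreasing_closed_net X B r H \<and> closedin X G \<and> (\<Inter>\<alpha>\<in>B. H \<alpha>) \<subseteq> G \<longrightarrow>
        (INF \<alpha>\<in>B. c (H \<alpha>)) \<le> c G"
    using assms(1) unfolding tau_capacities_def mem_Collect_eq by (elim conjE) assumption
  ultimately have "(INF \<alpha>\<in>F ` A. c (id \<alpha>)) \<le> c G"
    using assms(3) by metis
  then show ?thesis by (simp add: image_image)
qed

definition compact_capacities :: "'a topology \<Rightarrow> ('a set \<Rightarrow> real) set" where
  "compact_capacities K = {c \<in> Collect (closedin K) \<rightarrow>\<^sub>E {0..1}.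
     c {} = 0 \<and> c (topspace K) = 1 \<and>
     (\<forall>F G. closedin K F \<and> closedin K G \<and> F \<subseteq> G \<longrightarrow> c F \<le> c G) \<and>
     (\<forall>F a. closedin K F \<and> c F < a \<longrightarrow>
        (\<exists>U. openin K U \<and> F \<subseteq> U \<and> (\<forall>G. closedin K G \<and> G \<subseteq> U \<longrightarrow> c G < a)))}"

definition compact_capacity_space :: "'a topology \<Rightarrow> ('a set \<Rightarrow> real) topology" where
  "compact_capacity_space K = topology_generated_by
     ({{c \<in> compact_capacities K. c F < a} | F a. closedin K F} \<union>
      {{c \<in> compact_capacities K. \<exists>F. compactin K F \<and> F \<subseteq> U \<and> c F > a} | U a. openin K U})"

text \<open>The closure of the image of \<open>X\<close> in the cube \<open>[0,1]\<^sup>C\<close>, where \<open>C\<close> is the set of all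
  continuous functions from \<open>X\<close> to \<open>[0,1]\<close>.\<close>

definition unit_maps :: "'a topology \<Rightarrow> ('a \<Rightarrow> real) set" where
  "unit_maps X = {f \<in> extensional (topspace X). continuous_map X (top_of_set {0..1}) f}"

definition unit_cube :: "'a topology \<Rightarrow> (('a \<Rightarrow> real) \<Rightarrow> real) topology" where
  "unit_cube X = product_topology (\<lambda>f. top_of_set {0..1}) (unit_maps X)"

definition stone_cech_embed :: "'a topology \<Rightarrow> 'a \<Rightarrow> (('a \<Rightarrow> real) \<Rightarrow> real)" where
  "stone_cech_embed X x = (\<lambda>f\<in>unit_maps X. f x)"

definition stone_cech :: "'a topology \<Rightarrow> (('a \<Rightarrow> real) \<Rightarrow> real) topology" where
  "stone_cech X = subtopology (unit_cube X) (unit_cube X closure_of (stone_cech_embed X ` topspace X))"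

text \<open>With \<open>X\<close> identified with its image in the compactification, \<open>F \<inter> X\<close> is the preimage of \<open>F\<close>
  under the embedding.\<close>

definition capacity_embed ::
    "'a topology \<Rightarrow> ('a set \<Rightarrow> real) \<Rightarrow> ((('a \<Rightarrow> real) \<Rightarrow> real) set \<Rightarrow> real)" where
  "capacity_embed X c =
     (\<lambda>F\<in>Collect (closedin (stone_cech X)). c {x \<in> topspace X. stone_cech_embed X x \<in> F})"

definition capacity_space :: "'a topology \<Rightarrow> ('a set \<Rightarrow> real) topology" where
  "capacity_space X =
     pullback_topology (tau_capacities X) (capacity_embed X) (compact_capacity_space (stone_cech X))"

definition capacity_map ::
    "'a topology \<Rightarrow> 'b topology \<Rightarrow> ('a \<Rightarrow> 'b) \<Rightarrow> ('a set \<Rightarrow> real) \<Rightarrow> ('b set \<Rightarrow> real)" where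
  "capacity_map X Y f c = (\<lambda>F\<in>Collect (closedin Y). c {x \<in> topspace X. f x \<in> F})"

definition capacity_unit :: "'a topology \<Rightarrow> 'a \<Rightarrow> ('a set \<Rightarrow> real)" where
  "capacity_unit X x = (\<lambda>F\<in>Collect (closedin X). if x \<in> F then 1 else 0)"

definition capacity_mult ::
    "'a topology \<Rightarrow> (('a set \<Rightarrow> real) set \<Rightarrow> real) \<Rightarrow> ('a set \<Rightarrow> real)" where
  "capacity_mult X C =
     (\<lambda>F\<in>Collect (closedin X). SUP \<alpha>\<in>{0..1}. min \<alpha> (C {c \<in> topspace (capacity_space X). c F \<ge> \<alpha>}))"

lemma compact_unit_cube: "compact_space (unit_cube X)"
  unfolding unit_cube_def by (simp add: compact_space_product_topology compact_space_subtopology)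

lemma Hausdorff_unit_cube: "Hausdorff_space (unit_cube X)"
  unfolding unit_cube_def by (simp add: Hausdorff_space_product_topology Hausdorff_space_subtopology)

lemma compact_space_stone_cech: "compact_space (stone_cech X)"
  unfolding stone_cech_def
  by (simp add: closedin_compact_space compact_space_subtopology compact_unit_cube)

lemma Hausdorff_space_stone_cech: "Hausdorff_space (stone_cech X)"
  unfolding stone_cech_def by (simp add: Hausdorff_space_subtopology Hausdorff_unit_cube)

lemma unit_maps_eq:
  "unit_maps X = mspace (submetric (cfunspace X euclidean_metric) {f. f \<in> topspace X \<rightarrow> {0..1}})"
proof -
  have "bounded (f ` topspace X)" if "f \<in> topspace X \<rightarrow> {0..1}" for f :: "_ \<Rightarrow> real"
    by (meson bounded_closed_interval bounded_subset image_subset_iff_funcset that)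
  then show ?thesis
    by (auto simp: unit_maps_def continuous_map_in_subtopology image_subset_iff_funcset)
qed

lemma embed_in_cube: "stone_cech_embed X ` topspace X \<subseteq> topspace (unit_cube X)"
proof -
  have "f x \<in> {0..1}" if "f \<in> unit_maps X" "x \<in> topspace X" for f x
    using that continuous_map_image_subset_topspace[of X "top_of_set {0..1}" f]
    by (auto simp: unit_maps_def simp del: atLeastAtMost_iff)
  then show ?thesis
    by (simp add: image_subset_iff stone_cech_embed_def unit_cube_def restrict_PiE_iff)
qed

lemma embed_in_closure:
  "stone_cech_embed X ` topspace X \<subseteq> unit_cube X closure_of (stone_cech_embed X ` topspace X)"
  by (rule closure_of_subset[OF embed_in_cube])

lemma embedding_stone_cech:
  assumes "tychonoff_space X"
  shows "embedding_map X (stone_cech X) (stone_cech_embed X)"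
proof -
  have "embedding_map X (unit_cube X) (\<lambda>x. \<lambda>f\<in>unit_maps X. f x)"
    using completely_regular_space_cube_embedding_explicit[of X] assms
    unfolding unit_maps_eq unit_cube_def tychonoff_space_def by blast
  then have "embedding_map X (unit_cube X) (stone_cech_embed X)"
    by (simp add: stone_cech_embed_def[abs_def])
  then show ?thesis
    unfolding stone_cech_def embedding_map_in_subtopology using embed_in_closure by (intro conjI)
qed

lemma dense_stone_cech:
  "stone_cech X closure_of (stone_cech_embed X ` topspace X) = topspace (stone_cech X)"
proof -
  let ?S = "stone_cech_embed X ` topspace X" and ?C = "unit_cube X closure_of (stone_cech_embed X ` topspace X)"
  have "subtopology (unit_cube X) ?C closure_of ?S = ?C \<inter> unit_cube X closure_of (?C \<inter> ?S)"
    by (rule closure_of_subtopology)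
  also have "?C \<inter> ?S = ?S"
    using embed_in_closure[of X] by (rule Int_absorb1)
  also have "?C \<inter> ?C = topspace (subtopology (unit_cube X) ?C)"
    using closure_of_subset_topspace[of "unit_cube X" ?S] by (simp add: Int_absorb1)
  finally show ?thesis by (simp add: stone_cech_def)
qed

lemma continuous_map_stone_cech_embed: "continuous_map X (stone_cech X) (stone_cech_embed X)"
  unfolding stone_cech_def continuous_map_in_subtopology
proof
  show "continuous_map X (unit_cube X) (stone_cech_embed X)"
    unfolding unit_cube_def continuous_map_componentwise
    by (auto simp: stone_cech_embed_def unit_maps_def)
  show "stone_cech_embed X \<in> topspace X \<rightarrow> unit_cube X closure_of stone_cech_embed X ` topspace X"
    using embed_in_closure by (metis image_subset_iff_funcset)
qed

lemma closedin_preimage_stone_cech: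
  "closedin (stone_cech X) F \<Longrightarrow> closedin X {x \<in> topspace X. stone_cech_embed X x \<in> F}"
  by (rule closedin_continuous_map_preimage[OF continuous_map_stone_cech_embed])

lemma capacity_embed_in:
  assumes c: "c \<in> tau_capacities X"
  shows "capacity_embed X c \<in> compact_capacities (stone_cech X)"
proof -
  let ?K = "stone_cech X"
  define p where "p F = {x \<in> topspace X. stone_cech_embed X x \<in> F}" for F
  have e: "capacity_embed X c F = c (p F)" if "closedin ?K F" for F
    using that by (simp add: capacity_embed_def p_def)
  have cl: "closedin X (p F)" if "closedin ?K F" for F
    using closedin_preimage_stone_cech[OF that] by (simp add: p_def)
  have c': "c \<in> Collect (closedin X) \<rightarrow>\<^sub>E {0..1}" "c {} = 0" "c (topspace X) = 1"
    and mono: "\<And>F G. closedin X F \<Longrightarrow> closedin X G \<Longrightarrow> F \<subseteq> G \<Longrightarrow> c F \<le> c G"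
    using c by (simp_all add: tau_capacities_def)
  have pt: "p (topspace ?K) = topspace X" "p {} = {}"
    using continuous_map_stone_cech_embed[of X] by (auto simp: p_def continuous_map_def)
  have 1: "capacity_embed X c \<in> Collect (closedin ?K) \<rightarrow>\<^sub>E {0..1}"
  proof (rule PiE_I)
    show "capacity_embed X c F \<in> {0..1}" if "F \<in> Collect (closedin ?K)" for F
      using that e[of F] PiE_mem[OF c'(1), of "p F"] cl by simp
    show "capacity_embed X c F = undefined" if "F \<notin> Collect (closedin ?K)" for F
      using that by (simp add: capacity_embed_def)
  qed
  have pmono: "p F \<subseteq> p G" if "F \<subseteq> G" for F G
    using that by (auto simp: p_def)
  have usc: "\<exists>U. openin ?K U \<and> F \<subseteq> U \<and> (\<forall>G. closedin ?K G \<and> G \<subseteq> U \<longrightarrow> capacity_embed X c G < a)"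
    if F: "closedin ?K F" and a: "capacity_embed X c F < a" for F a
  proof -
    define N where "N = {N. closedin ?K N \<and> (\<exists>U. openin ?K U \<and> F \<subseteq> U \<and> U \<subseteq> N)}"
    define r where "r = {(S, T). S \<in> N \<and> T \<in> N \<and> T \<subseteq> S}"
    have topN: "topspace ?K \<in> N"
      using F unfolding N_def by (auto dest: closedin_subset intro!: exI[of _ "topspace ?K"])
    have int: "S \<inter> T \<in> N" if "S \<in> N" "T \<in> N" for S T
    proof -
      from that obtain U V where "openin ?K U" "F \<subseteq> U" "U \<subseteq> S" "openin ?K V" "F \<subseteq> V" "V \<subseteq> T"
        by (auto simp: N_def)
      then have "openin ?K (U \<inter> V) \<and> F \<subseteq> U \<inter> V \<and> U \<inter> V \<subseteq> S \<inter> T" by auto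
      moreover have "closedin ?K (S \<inter> T)" using that by (auto simp: N_def)
      ultimately show ?thesis unfolding N_def by blast
    qed
    have "decreasing_closed_net X N r p"
      unfolding decreasing_closed_net_def
    proof (intro conjI ballI)
      show "preorder_on N r"
        by (auto simp: preorder_on_def r_def refl_on_def intro!: transI)
      show "\<exists>\<gamma>\<in>N. (S, \<gamma>) \<in> r \<and> (T, \<gamma>) \<in> r" if "S \<in> N" "T \<in> N" for S T
        using that int[OF that] by (intro bexI[of _ "S \<inter> T"]) (auto simp: r_def)
    qed (use topN cl pmono in \<open>auto simp: N_def r_def\<close>)
    moreover have "(\<Inter>S\<in>N. p S) \<subseteq> p F"
    proof
      fix x assume x: "x \<in> (\<Inter>S\<in>N. p S)"
      then have xX: "x \<in> topspace X" using topN by (auto simp: p_def)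
      let ?y = "stone_cech_embed X x"
      have y: "?y \<in> topspace ?K" using x topN by (auto simp: p_def)
      show "x \<in> p F"
      proof (rule ccontr)
        assume "x \<notin> p F"
        then have yF: "?y \<notin> F" using xX by (simp add: p_def)
        have "regular_space ?K"
          by (simp add: compact_Hausdorff_imp_regular_space compact_space_stone_cech
              Hausdorff_space_stone_cech)
        then obtain V U where VU: "openin ?K V" "openin ?K U" "?y \<in> V" "F \<subseteq> U" "disjnt V U"
          using F y yF unfolding regular_space_def by (meson DiffI)
        have "U \<subseteq> topspace ?K - V"
          using VU openin_subset[OF VU(2)] by (auto simp: disjnt_def)
        then have "topspace ?K - V \<in> N" unfolding N_def using VU by blast
        then show False using x VU by (auto simp: p_def)
      qed
    qed
    ultimately have "(INF S\<in>N. c (p S)) \<le> c (p F)"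
      using tau_capacity_net[OF c] cl[OF F] by blast
    then have "(INF S\<in>N. c (p S)) < a" using a e[OF F] by simp
    then obtain S where S: "S \<in> N" "c (p S) < a"
      using cInf_lessD[of "(\<lambda>S. c (p S)) ` N" a] topN by blast
    then obtain U where U: "closedin ?K S" "openin ?K U" "F \<subseteq> U" "U \<subseteq> S" by (auto simp: N_def)
    have "capacity_embed X c G < a" if "closedin ?K G" "G \<subseteq> U" for G
    proof -
      have "c (p G) \<le> c (p S)" using that U by (intro mono cl pmono) auto
      then show ?thesis using S e that by simp
    qed
    then show ?thesis using U by blast
  qed
  have "capacity_embed X c {} = 0" "capacity_embed X c (topspace ?K) = 1"
    using e pt c' by simp_all
  moreover have "capacity_embed X c F \<le> capacity_embed X c G"
    if "closedin ?K F" "closedin ?K G" "F \<subseteq> G" for F G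
    using that e mono[OF cl cl pmono] by simp
  ultimately show ?thesis
    using 1 usc unfolding compact_capacities_def mem_Collect_eq by (intro conjI allI impI) metis+
qed

lemma topspace_compact_capacity_space:
  "topspace (compact_capacity_space K) = compact_capacities K"
proof -
  have "c (topspace K) < 2" if "c \<in> compact_capacities K" for c
    using that by (simp add: compact_capacities_def)
  then have "compact_capacities K = {c \<in> compact_capacities K. c (topspace K) < 2}" by blast
  then show ?thesis
    unfolding compact_capacity_space_def topology_generated_by_topspace by blast
qed

lemma topspace_capacity_space: "topspace (capacity_space X) = tau_capacities X"
  unfolding capacity_space_def topspace_pullback_topology topspace_compact_capacity_space
  using capacity_embed_in by blast

lemma closed_trace_stone_cech:
  assumes X: "tychonoff_space X" and F: "closedin X F"
  obtains F' where "closedin (stone_cech X) F'" "F = {x \<in> topspace X. stone_cech_embed X x \<in> F'}"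
proof -
  let ?K = "stone_cech X" and ?e = "stone_cech_embed X"
  have h: "homeomorphic_map X (subtopology ?K (?e ` topspace X)) ?e"
    using embedding_stone_cech[OF X] by (simp add: embedding_map_def)
  have FX: "F \<subseteq> topspace X" using F by (rule closedin_subset)
  have "closedin (subtopology ?K (?e ` topspace X)) (?e ` F)"
    using homeomorphic_map_closedness[OF h FX] F by simp
  then obtain F' where F': "closedin ?K F'" "?e ` F = F' \<inter> ?e ` topspace X"
    by (auto simp: closedin_subtopology)
  have "inj_on ?e (topspace X)"
    using h by (rule homeomorphic_imp_injective_map)
  then have "F = {x \<in> topspace X. ?e x \<in> F'}"
  proof (intro set_eqI iffI)
    show "x \<in> {x \<in> topspace X. ?e x \<in> F'}" if "x \<in> F" for x
      using that F'(2) FX by blast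
    show "x \<in> F" if x: "x \<in> {x \<in> topspace X. ?e x \<in> F'}" for x
    proof -
      have "?e x \<in> ?e ` F" using x F'(2) by auto
      then show ?thesis using \<open>inj_on ?e (topspace X)\<close> FX x by (simp add: inj_on_image_mem_iff)
    qed
  qed
  then show thesis using that F' by blast
qed

lemma capacity_embed_inj:
  assumes X: "tychonoff_space X"
  shows "inj_on (capacity_embed X) (tau_capacities X)"
proof (rule inj_onI)
  fix c d assume cd: "c \<in> tau_capacities X" "d \<in> tau_capacities X"
    and eq: "capacity_embed X c = capacity_embed X d"
  have "c F = d F" if F: "closedin X F" for F
  proof -
    obtain F' where "closedin (stone_cech X) F'" "F = {x \<in> topspace X. stone_cech_embed X x \<in> F'}"
      using closed_trace_stone_cech[OF X F] .
    then show ?thesis using fun_cong[OF eq, of F'] by (simp add: capacity_embed_def)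
  qed
  then show "c = d"
    using cd by (intro PiE_ext[of _ "Collect (closedin X)" "\<lambda>_. {0..1}"]) (auto simp: tau_capacities_def)
qed

text \<open>The sets to which \<open>C\<close> is applied in \<open>capacity_mult\<close> are closed.\<close>

lemma closedin_capacity_ge:
  assumes X: "tychonoff_space X" and F: "closedin X F"
  shows "closedin (capacity_space X) {c \<in> topspace (capacity_space X). c F \<ge> a}"
proof -
  let ?K = "stone_cech X"
  obtain F' where F': "closedin ?K F'" "F = {x \<in> topspace X. stone_cech_embed X x \<in> F'}"
    using closed_trace_stone_cech[OF X F] .
  let ?O = "{c \<in> compact_capacities ?K. c F' < a}"
  have O: "openin (compact_capacity_space ?K) ?O"
    unfolding compact_capacity_space_def openin_topology_generated_by_iff
    by (rule generate_topology_on.Basis) (use F'(1) in blast)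
  have "capacity_embed X c F' = c F" for c
    using F' by (simp add: capacity_embed_def)
  then have "capacity_embed X -` ?O \<inter> tau_capacities X = {c \<in> tau_capacities X. c F < a}"
    using capacity_embed_in by auto
  then have "openin (capacity_space X) {c \<in> tau_capacities X. c F < a}"
    unfolding capacity_space_def openin_pullback_topology using O by (intro exI[of _ ?O]) simp
  moreover have "{c \<in> topspace (capacity_space X). c F \<ge> a} =
      topspace (capacity_space X) - {c \<in> tau_capacities X. c F < a}"
    by (auto simp: topspace_capacity_space)
  ultimately show ?thesis by auto
qed

end

theory Submission
  imports Defs
begin

text \<open>
  The Sugeno integral \<open>I\<^sub>\<phi>(c) = sup {t \<and> c {\<phi> \<ge> t}}\<close> of an upper semicontinuous \<open>\<phi> : X \<rightarrow> [0,1]\<close>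
  satisfies \<open>I\<^sub>\<phi>(c) \<ge> a \<longleftrightarrow> c {\<phi> \<ge> a} \<ge> a\<close> by \<open>\<tau>\<close>-smoothness, and \<open>\<mu>(C)(F)\<close> is the integral of the
  evaluation at \<open>F\<close> with respect to \<open>C\<close>. Comparing superlevel sets therefore proves the \<open>\<tau>\<close>-smoothness
  of \<open>\<mu>(C)\<close>, the identity \<open>I\<^sub>\<phi>(\<mu>(C)) = I\<^bsub>I\<^sub>\<phi>\<^esub>(C)\<close> and the monad laws.
  The topology of the space of capacities is the weak topology of the functionals \<open>I\<^sub>\<phi>\<close> with \<open>\<phi>\<close>
  continuous, and these separate capacities. So the space of capacities embeds in a cube, and
  continuity of \<open>M f\<close>, \<open>\<eta>\<close>, \<open>\<mu>\<close> follows from \<open>I\<^sub>\<phi> \<circ> M f = I\<^bsub>\<phi> \<circ> f\<^esub>\<close>, \<open>I\<^sub>\<phi> \<circ> \<eta> = \<phi>\<close> and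
  \<open>I\<^sub>\<phi> \<circ> \<mu> = I\<^bsub>I\<^sub>\<phi>\<^esub>\<close>.
\<close>

section \<open>Values of capacities and smoothness along directed families\<close>

lemma tau_capacity_range:
  assumes "c \<in> tau_capacities X" "closedin X F"
  shows "0 \<le> c F" "c F \<le> 1"
proof -
  have "c \<in> Collect (closedin X) \<rightarrow>\<^sub>E {0..1}" using assms(1) by (simp add: tau_capacities_def)
  from PiE_mem[OF this, of F] assms(2) show "0 \<le> c F" "c F \<le> 1" by simp_all
qed

lemma tau_capacity_mono:
  assumes "c \<in> tau_capacities X" "closedin X F" "closedin X G" "F \<subseteq> G"
  shows "c F \<le> c G"
  using assms by (simp add: tau_capacities_def)

lemma tau_capacity_empty: "c \<in> tau_capacities X \<Longrightarrow> c {} = 0"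
  and tau_capacity_topspace: "c \<in> tau_capacities X \<Longrightarrow> c (topspace X) = 1"
  by (simp_all add: tau_capacities_def)

text \<open>The family serves as its own index set, preordered by reverse inclusion. A common lower
  bound \<open>a\<close> replaces the infimum, so that later arguments handle only inequalities at a
  fixed level.\<close>

lemma tau_capacity_directed:
  fixes X :: "'a topology"
  assumes c: "c \<in> tau_capacities X" and ne: "\<F> \<noteq> {}"
    and cl: "\<And>S. S \<in> \<F> \<Longrightarrow> closedin X S"
    and dir: "\<And>S T. S \<in> \<F> \<Longrightarrow> T \<in> \<F> \<Longrightarrow> \<exists>R\<in>\<F>. R \<subseteq> S \<and> R \<subseteq> T"
    and G: "closedin X G" "\<Inter>\<F> \<subseteq> G"
    and ge: "\<And>S. S \<in> \<F> \<Longrightarrow> a \<le> c S"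
  shows "a \<le> c G"
proof -
  define r where "r = {(S, T). S \<in> \<F> \<and> T \<in> \<F> \<and> T \<subseteq> S}"
  have "preorder_on \<F> r"
    by (auto simp: preorder_on_def r_def refl_on_def intro!: transI)
  moreover have "\<exists>\<gamma>\<in>\<F>. (S, \<gamma>) \<in> r \<and> (T, \<gamma>) \<in> r" if "S \<in> \<F>" "T \<in> \<F>" for S T
    using dir[OF that] that by (auto simp: r_def)
  ultimately have "decreasing_closed_net X \<F> r id"
    using ne cl unfolding decreasing_closed_net_def by (auto simp: r_def)
  then have "(INF S\<in>\<F>. c (id S)) \<le> c G"
    using tau_capacity_net[OF c _ G(1), of \<F> r id] G(2) by simp
  moreover have "a \<le> (INF S\<in>\<F>. c (id S))"
    using ne ge by (intro cINF_greatest) auto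
  ultimately show ?thesis by simp
qed

text \<open>A net enters only through the family of its values, and the threshold \<open>a\<close>
  is taken to be the infimum of the capacities along the net. This infimum lies in the unit
  interval, so levels between 0 and 1 suffice.\<close>

lemma tau_capacityI:
  fixes X :: "'a topology"
  assumes ext: "c \<in> extensional (Collect (closedin X))"
    and range: "\<And>F. closedin X F \<Longrightarrow> 0 \<le> c F \<and> c F \<le> 1"
    and "c {} = 0" "c (topspace X) = 1"
    and mono: "\<And>F G. closedin X F \<Longrightarrow> closedin X G \<Longrightarrow> F \<subseteq> G \<Longrightarrow> c F \<le> c G"
    and smooth: "\<And>\<F> G a. \<F> \<noteq> {} \<Longrightarrow> (\<And>S. S \<in> \<F> \<Longrightarrow> closedin X S) \<Longrightarrow>
       (\<And>S T. S \<in> \<F> \<Longrightarrow> T \<in> \<F> \<Longrightarrow> \<exists>R\<in>\<F>. R \<subseteq> S \<and> R \<subseteq> T) \<Longrightarrow> closedin X G \<Longrightarrow> \<Inter>\<F> \<subseteq> G \<Longrightarrow>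
       0 \<le> a \<Longrightarrow> a \<le> 1 \<Longrightarrow> (\<And>S. S \<in> \<F> \<Longrightarrow> a \<le> c S) \<Longrightarrow> a \<le> c G"
  shows "c \<in> tau_capacities X"
proof -
  have net_le: "(INF \<alpha>\<in>A. c (F \<alpha>)) \<le> c G"
    if net: "decreasing_closed_net X A r F" and G: "closedin X G" "(\<Inter>\<alpha>\<in>A. F \<alpha>) \<subseteq> G"
    for A :: "'a set set" and r F G
  proof (rule smooth[of "F ` A"])
    have A: "A \<noteq> {}" "\<forall>\<alpha>\<in>A. \<forall>\<beta>\<in>A. \<exists>\<gamma>\<in>A. (\<alpha>, \<gamma>) \<in> r \<and> (\<beta>, \<gamma>) \<in> r"
       "\<forall>\<alpha>\<in>A. closedin X (F \<alpha>)" "\<forall>\<alpha> \<beta>. (\<alpha>, \<beta>) \<in> r \<longrightarrow> F \<beta> \<subseteq> F \<alpha>"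
      using net by (auto simp: decreasing_closed_net_def)
    have r: "0 \<le> c (F \<alpha>) \<and> c (F \<alpha>) \<le> 1" if "\<alpha> \<in> A" for \<alpha>
      using range A(3) that by blast
    have bdd: "bdd_below ((\<lambda>\<alpha>. c (F \<alpha>)) ` A)"
      using r by (intro bdd_belowI2[of _ 0]) auto
    show le: "(INF \<alpha>\<in>A. c (F \<alpha>)) \<le> c S" if "S \<in> F ` A" for S
      using that bdd by (auto intro: cINF_lower)
    show "F ` A \<noteq> {}" "closedin X G" "\<Inter>(F ` A) \<subseteq> G" using A G by auto
    show "closedin X S" if "S \<in> F ` A" for S using that A(3) by auto
    show "0 \<le> (INF \<alpha>\<in>A. c (F \<alpha>))" using A(1) r by (intro cINF_greatest) auto
    obtain \<alpha> where "\<alpha> \<in> A" using A(1) by blast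
    then show "(INF \<alpha>\<in>A. c (F \<alpha>)) \<le> 1" using le[of "F \<alpha>"] r[of \<alpha>] by auto
    show "\<exists>R\<in>F ` A. R \<subseteq> S \<and> R \<subseteq> T" if ST: "S \<in> F ` A" "T \<in> F ` A" for S T
    proof -
      obtain \<alpha> \<beta> where \<alpha>\<beta>: "\<alpha> \<in> A" "\<beta> \<in> A" "S = F \<alpha>" "T = F \<beta>" using ST by blast
      then obtain \<gamma> where "\<gamma> \<in> A" "(\<alpha>, \<gamma>) \<in> r" "(\<beta>, \<gamma>) \<in> r" using A(2) by blast
      then have "F \<gamma> \<in> F ` A" "F \<gamma> \<subseteq> S" "F \<gamma> \<subseteq> T" using A(4) \<alpha>\<beta> by auto
      then show ?thesis by blast
    qed
  qed
  have "c \<in> Collect (closedin X) \<rightarrow>\<^sub>E {0..1}"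
    using ext range by (auto simp: PiE_iff)
  then show ?thesis
    using assms(3,4) unfolding tau_capacities_def mem_Collect_eq
    by (intro conjI allI impI; (elim conjE)?) (assumption | rule mono net_le; assumption)+
qed

text \<open>Test the levels \<open>x\<close> and \<open>y\<close> themselves. Level 0 can be left
  out because both numbers are nonnegative.\<close>

lemma unit_eq_thresholdI:
  fixes x y :: real
  assumes "0 \<le> x" "x \<le> 1" "0 \<le> y" "y \<le> 1" "\<And>a. 0 < a \<Longrightarrow> a \<le> 1 \<Longrightarrow> a \<le> x \<longleftrightarrow> a \<le> y"
  shows "x = y"
  using assms(5)[of x] assms(5)[of y] assms(1-4) by linarith

text \<open>On closed sets the thresholds determine the value; elsewhere both functions are
  \<open>undefined\<close>. All monad identities are proved through this criterion or by direct
  extensionality.\<close>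

lemma tau_capacity_eqI:
  assumes "c \<in> tau_capacities X" "d \<in> tau_capacities X"
    and "\<And>F a. closedin X F \<Longrightarrow> 0 < a \<Longrightarrow> a \<le> 1 \<Longrightarrow> a \<le> c F \<longleftrightarrow> a \<le> d F"
  shows "c = d"
proof (rule PiE_ext[of _ "Collect (closedin X)" "\<lambda>_. {0..1}"])
  show "c F = d F" if "F \<in> Collect (closedin X)" for F
    using that assms tau_capacity_range[of _ X F] by (intro unit_eq_thresholdI) auto
qed (use assms in \<open>auto simp: tau_capacities_def\<close>)

section \<open>Sugeno integrals and their superlevel sets\<close>

definition sugeno :: "'a topology \<Rightarrow> ('a set \<Rightarrow> real) \<Rightarrow> ('a \<Rightarrow> real) \<Rightarrow> real" where
  "sugeno X c \<phi> = (SUP t\<in>{0..1}. min t (c {x \<in> topspace X. t \<le> \<phi> x}))"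

lemma sugeno_cong:
  assumes "\<And>x. x \<in> topspace X \<Longrightarrow> \<phi> x = \<psi> x"
  shows "sugeno X c \<phi> = sugeno X c \<psi>"
proof -
  have "{x \<in> topspace X. t \<le> \<phi> x} = {x \<in> topspace X. t \<le> \<psi> x}" for t
    using assms by auto
  then show ?thesis by (simp add: sugeno_def)
qed

lemma bdd_above_sugeno: "bdd_above ((\<lambda>t. min t (c {x \<in> topspace X. t \<le> \<phi> x})) ` {0..1::real})"
  by (rule bdd_aboveI2[of _ _ 1]) auto

text \<open>A strict bound on a supremum is witnessed by a single level \<open>t\<close>; this holds
  for any set function and any integrand.\<close>

lemma less_sugeno_iff:
  "a < sugeno X c \<phi> \<longleftrightarrow> (\<exists>t\<in>{0..1}. a < t \<and> a < c {x \<in> topspace X. t \<le> \<phi> x})"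
  unfolding sugeno_def by (subst less_cSUP_iff[OF _ bdd_above_sugeno]) auto

lemma sugeno_upper: "0 \<le> t \<Longrightarrow> t \<le> 1 \<Longrightarrow> min t (c {x \<in> topspace X. t \<le> \<phi> x}) \<le> sugeno X c \<phi>"
  unfolding sugeno_def by (rule cSUP_upper[OF _ bdd_above_sugeno]) auto

lemma sugeno_le_1: "sugeno X c \<phi> \<le> 1"
  unfolding sugeno_def by (rule cSUP_least) auto

text \<open>Closed superlevel sets are what a capacity can measure. The class has to include the
  evaluations \<open>\<lambda>c. c F\<close> at closed sets, which are the integrands of
  \<open>capacity_mult\<close>.\<close>

definition usc_on :: "'a topology \<Rightarrow> ('a \<Rightarrow> real) \<Rightarrow> bool" where
  "usc_on X \<phi> \<longleftrightarrow> (\<forall>t. closedin X {x \<in> topspace X. t \<le> \<phi> x})"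

lemma usc_onD: "usc_on X \<phi> \<Longrightarrow> closedin X {x \<in> topspace X. t \<le> \<phi> x}"
  by (simp add: usc_on_def)

lemma sugeno_nonneg:
  assumes "c \<in> tau_capacities X" "usc_on X \<phi>"
  shows "0 \<le> sugeno X c \<phi>"
  using sugeno_upper[of 0 c X \<phi>] tau_capacity_range[OF assms(1) usc_onD[OF assms(2), of 0]] by simp

text \<open>The superlevel set at \<open>a\<close> is the intersection of those at the levels below
  \<open>a\<close>, so smoothness carries the bounds from these levels to \<open>a\<close>. In the
  other direction \<open>a\<close> itself is an admissible level.\<close>

lemma le_sugeno_iff:
  assumes c: "c \<in> tau_capacities X" and usc: "usc_on X \<phi>" and a: "0 \<le> a" "a \<le> 1"
  shows "a \<le> sugeno X c \<phi> \<longleftrightarrow> a \<le> c {x \<in> topspace X. a \<le> \<phi> x}"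
proof
  let ?L = "\<lambda>t. {x \<in> topspace X. t \<le> \<phi> x}"
  show "a \<le> sugeno X c \<phi>" if "a \<le> c (?L a)"
    using sugeno_upper[OF a, of c X \<phi>] that by simp
  assume ge: "a \<le> sugeno X c \<phi>"
  \<comment> \<open>The supremum exceeds \<open>s\<close>, which gives a level \<open>t\<close>
    above \<open>s\<close>; lowering it to \<open>s\<close> only enlarges the set.\<close>
  have L: "s < c (?L s)" if s: "s < a" for s
  proof -
    obtain t where t: "s < t" "s < c (?L t)"
      using ge s less_sugeno_iff[of s X c \<phi>] by auto
    have "c (?L t) \<le> c (?L s)"
      using t(1) by (intro tau_capacity_mono[OF c usc_onD[OF usc] usc_onD[OF usc]]) auto
    then show ?thesis using t by simp
  qed
  show "a \<le> c (?L a)"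
  \<comment> \<open>For fixed \<open>b\<close>, the levels in \<open>{b..<a}\<close> give a directed
    family on which \<open>b\<close> is a uniform lower bound.\<close>
  proof (rule dense_le)
    fix b assume b: "b < a"
    show "b \<le> c (?L a)"
    proof (rule tau_capacity_directed[OF c, of "?L ` {b..<a}"])
      show "\<Inter>(?L ` {b..<a}) \<subseteq> ?L a"
      proof
        fix x assume x: "x \<in> \<Inter>(?L ` {b..<a})"
        then have "x \<in> ?L b" using b by auto
        moreover have "a \<le> \<phi> x"
          using b by (rule dense_le_bounded) (use x in auto)
        ultimately show "x \<in> ?L a" by simp
      qed
      show "\<exists>R\<in>?L ` {b..<a}. R \<subseteq> S \<and> R \<subseteq> T" if ST: "S \<in> ?L ` {b..<a}" "T \<in> ?L ` {b..<a}" for S T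
      proof -
        obtain s t where st: "s \<in> {b..<a}" "t \<in> {b..<a}" "S = ?L s" "T = ?L t" using ST by blast
        then have "max s t \<in> {b..<a}" "?L (max s t) \<subseteq> S" "?L (max s t) \<subseteq> T" by auto
        then show ?thesis by blast
      qed
      show "b \<le> c S" if "S \<in> ?L ` {b..<a}" for S
        using that L by force
    qed (use b usc_onD[OF usc] in auto)
  qed
qed

lemma sugeno_less_iff:
  assumes "c \<in> tau_capacities X" "usc_on X \<phi>" "0 \<le> a" "a \<le> 1"
  shows "sugeno X c \<phi> < a \<longleftrightarrow> c {x \<in> topspace X. a \<le> \<phi> x} < a"
  using le_sugeno_iff[OF assms] by auto

section \<open>Continuity of Sugeno integrals of continuous functions\<close>

lemma usc_on_continuous:
  assumes "continuous_map X (top_of_set {0..1}) \<phi>"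
  shows "usc_on X \<phi>"
proof -
  have "continuous_map X euclideanreal \<phi>" using assms by (simp add: continuous_map_in_subtopology)
  then show ?thesis
    using closedin_continuous_map_preimage[of X euclideanreal \<phi> "{t..}" for t] by (simp add: usc_on_def)
qed

lemma usc_on_eval:
  assumes "tychonoff_space X" "closedin X F"
  shows "usc_on (capacity_space X) (\<lambda>c. c F)"
  using closedin_capacity_ge[OF assms] by (simp add: usc_on_def)

lemma unit_map_range:
  assumes "continuous_map X (top_of_set {0..1}) \<phi>" "x \<in> topspace X"
  shows "0 \<le> \<phi> x" "\<phi> x \<le> (1::real)"
  using continuous_map_image_subset_topspace[OF assms(1)] assms(2) by auto

lemma unit_map_iff:
  "continuous_map X (top_of_set {0..1}) \<phi> \<longleftrightarrow>
     continuous_map X euclideanreal \<phi> \<and> (\<forall>x\<in>topspace X. 0 \<le> \<phi> x \<and> \<phi> x \<le> 1)"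
  by (auto simp: continuous_map_in_subtopology)

lemma restrict_unit_map:
  "continuous_map X (top_of_set {0..1}) \<phi> \<Longrightarrow> restrict \<phi> (topspace X) \<in> unit_maps X"
  by (auto simp: unit_maps_def intro: continuous_map_eq)

text \<open>Composed with \<open>stone_cech_embed X\<close>, this coordinate is
  \<open>\<phi>\<close>; it is the continuous extension of \<open>\<phi>\<close> to the
  compactification.\<close>

lemma continuous_map_stone_cech_proj:
  assumes "\<phi> \<in> unit_maps X"
  shows "continuous_map (stone_cech X) euclideanreal (\<lambda>y. y \<phi>)"
proof -
  have "continuous_map (unit_cube X) (top_of_set {0..1}) (\<lambda>y. y \<phi>)"
    unfolding unit_cube_def using assms by (rule continuous_map_product_projection)
  then show ?thesis
    unfolding stone_cech_def
    by (intro continuous_map_from_subtopology) (simp add: continuous_map_in_subtopology)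
qed

lemma capacity_embed_apply:
  "closedin (stone_cech X) F \<Longrightarrow>
     capacity_embed X c F = c {x \<in> topspace X. stone_cech_embed X x \<in> F}"
  by (simp add: capacity_embed_def)

text \<open>For levels in the unit interval the complement is the closed set of capacities with
  value at least \<open>a\<close> on a superlevel set of \<open>\<phi>\<close>. Other levels give
  the empty set or the whole space.\<close>

lemma openin_sugeno_less:
  assumes X: "tychonoff_space X" and \<phi>: "continuous_map X (top_of_set {0..1}) \<phi>"
  shows "openin (capacity_space X) {c \<in> topspace (capacity_space X). sugeno X c \<phi> < a}"
proof -
  let ?M = "capacity_space X" and ?F = "{x \<in> topspace X. a \<le> \<phi> x}"
  note usc = usc_on_continuous[OF \<phi>]
  consider "a \<le> 0" | "0 \<le> a" "a \<le> 1" | "1 < a" by linarith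
  then show ?thesis
  proof cases
    case 1
    then have "{c \<in> topspace ?M. sugeno X c \<phi> < a} = {}"
      using sugeno_nonneg[OF _ usc] by (force simp: topspace_capacity_space)
    then show ?thesis using openin_empty by metis
  next
    case 2
    then have "{c \<in> topspace ?M. sugeno X c \<phi> < a} =
        topspace ?M - {c \<in> topspace ?M. a \<le> c ?F}"
      using sugeno_less_iff[OF _ usc] by (auto simp: topspace_capacity_space)
    then show ?thesis
      using closedin_capacity_ge[OF X usc_onD[OF usc]] by auto
  next
    case 3
    then have "{c \<in> topspace ?M. sugeno X c \<phi> < a} = topspace ?M"
      using sugeno_le_1[of X _ \<phi>] by (force intro: le_less_trans)
    then show ?thesis by simp
  qed
qed

text \<open>Rewrites the strict bound as the condition in the second kind of subbasic sets. A level
  \<open>t > a\<close> yields the compact superlevel set at \<open>t\<close> of the extended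
  function; conversely the extension attains its minimum on a compact \<open>F\<close>, and this
  minimum is a level above \<open>a\<close>.\<close>

lemma less_sugeno_iff_compact:
  assumes \<phi>: "\<phi> \<in> unit_maps X" and c: "c \<in> tau_capacities X" and a: "0 \<le> a"
  shows "a < sugeno X c \<phi> \<longleftrightarrow>
    (\<exists>F. compactin (stone_cech X) F \<and> F \<subseteq> {y \<in> topspace (stone_cech X). a < y \<phi>} \<and>
         a < capacity_embed X c F)"
proof
  let ?K = "stone_cech X" and ?e = "stone_cech_embed X"
  have cont: "continuous_map X (top_of_set {0..1}) \<phi>" using \<phi> by (simp add: unit_maps_def)
  have e: "?e x \<phi> = \<phi> x" for x using \<phi> by (simp add: stone_cech_embed_def)
  have eK: "?e x \<in> topspace ?K" if "x \<in> topspace X" for x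
    using that continuous_map_stone_cech_embed[of X] by (auto simp: continuous_map_def)
  show "\<exists>F. compactin ?K F \<and> F \<subseteq> {y \<in> topspace ?K. a < y \<phi>} \<and> a < capacity_embed X c F"
    if less: "a < sugeno X c \<phi>"
  proof -
    obtain t where t: "a < t" "a < c {x \<in> topspace X. t \<le> \<phi> x}"
      using less by (auto simp: less_sugeno_iff)
    let ?F = "{y \<in> topspace ?K. y \<phi> \<in> {t..}}"
    have cl: "closedin ?K ?F"
      by (rule closedin_continuous_map_preimage[OF continuous_map_stone_cech_proj[OF \<phi>]]) simp
    have "{x \<in> topspace X. ?e x \<in> ?F} = {x \<in> topspace X. t \<le> \<phi> x}"
      using eK e by auto
    then have "a < capacity_embed X c ?F"
      using t cl by (simp add: capacity_embed_apply)
    then show ?thesis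
      using t closedin_compact_space[OF compact_space_stone_cech cl] by (intro exI[of _ ?F]) auto
  qed
  assume "\<exists>F. compactin ?K F \<and> F \<subseteq> {y \<in> topspace ?K. a < y \<phi>} \<and> a < capacity_embed X c F"
  then obtain F where F: "compactin ?K F" "F \<subseteq> {y \<in> topspace ?K. a < y \<phi>}" "a < capacity_embed X c F"
    by blast
  let ?T = "{x \<in> topspace X. ?e x \<in> F}"
  have cl: "closedin ?K F"
    using F(1) Hausdorff_space_stone_cech by (rule compactin_imp_closedin[rotated])
  have T: "a < c ?T" using F(3) cl by (simp add: capacity_embed_apply)
  \<comment> \<open>The empty set has capacity 0, which does not exceed \<open>a\<close>.
    Nonemptiness is needed for the minimum to exist.\<close>
  have "?T \<noteq> {}" using T a tau_capacity_empty[OF c] by (metis not_le)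
  then have ne: "(\<lambda>y. y \<phi>) ` F \<noteq> {}" by auto
  have "compact ((\<lambda>y. y \<phi>) ` F)"
    using image_compactin[OF F(1) continuous_map_stone_cech_proj[OF \<phi>]] by simp
  then obtain t where t: "t \<in> (\<lambda>y. y \<phi>) ` F" "\<forall>s\<in>(\<lambda>y. y \<phi>) ` F. t \<le> s"
    using compact_attains_inf[OF _ ne] by blast
  have "a < t" using t(1) F(2) by auto
  \<comment> \<open>A point of the trace bounds the minimum by \<open>\<phi> x\<close>, so
    \<open>t\<close> is an admissible level.\<close>
  obtain x where x: "x \<in> topspace X" "?e x \<in> F" using \<open>?T \<noteq> {}\<close> by auto
  then have "t \<le> 1" using t(2) e unit_map_range(2)[OF cont x(1)] by (metis image_eqI order.trans)
  have "?T \<subseteq> {x \<in> topspace X. t \<le> \<phi> x}"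
    using t(2) by (auto simp flip: e)
  then have "c ?T \<le> c {x \<in> topspace X. t \<le> \<phi> x}"
    by (intro tau_capacity_mono[OF c closedin_preimage_stone_cech[OF cl] usc_onD[OF usc_on_continuous[OF cont]]])
  then show "a < sugeno X c \<phi>"
    using T \<open>a < t\<close> \<open>t \<le> 1\<close> a by (auto simp: less_sugeno_iff intro!: bexI[of _ t])
qed

text \<open>For nonnegative \<open>a\<close> this is the preimage under
  \<open>capacity_embed X\<close> of a subbasic set of the second kind; for negative
  \<open>a\<close> it is the whole space.\<close>

lemma openin_less_sugeno:
  assumes \<phi>: "\<phi> \<in> unit_maps X"
  shows "openin (capacity_space X) {c \<in> topspace (capacity_space X). a < sugeno X c \<phi>}"
proof (cases "0 \<le> a")
  case False
  have "continuous_map X (top_of_set {0..1}) \<phi>" using \<phi> by (simp add: unit_maps_def)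
  then have "{c \<in> topspace (capacity_space X). a < sugeno X c \<phi>} = topspace (capacity_space X)"
    using False sugeno_nonneg[OF _ usc_on_continuous]
    by (force simp: topspace_capacity_space)
  then show ?thesis by simp
next
  case True
  let ?K = "stone_cech X"
  let ?U = "{y \<in> topspace ?K. y \<phi> \<in> {a<..}}"
  let ?O = "{c \<in> compact_capacities ?K. \<exists>F. compactin ?K F \<and> F \<subseteq> ?U \<and> c F > a}"
  have U: "openin ?K ?U"
    by (rule openin_continuous_map_preimage[OF continuous_map_stone_cech_proj[OF \<phi>]]) simp
  have "openin (compact_capacity_space ?K) ?O"
    unfolding compact_capacity_space_def openin_topology_generated_by_iff
    by (rule generate_topology_on.Basis) (use U in blast)
  moreover have "capacity_embed X -` ?O \<inter> tau_capacities X = {c \<in> tau_capacities X. a < sugeno X c \<phi>}"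
    using capacity_embed_in less_sugeno_iff_compact[OF \<phi> _ True] by auto
  ultimately show ?thesis
    unfolding topspace_capacity_space unfolding capacity_space_def openin_pullback_topology
    by (intro exI[of _ ?O]) simp
qed

lemma continuous_map_sugeno:
  assumes X: "tychonoff_space X" and \<phi>: "continuous_map X (top_of_set {0..1}) \<phi>"
  shows "continuous_map (capacity_space X) (top_of_set {0..1}) (\<lambda>c. sugeno X c \<phi>)"
proof -
  \<comment> \<open>The coordinates of the cube are indexed by extensional functions, and the
    integral sees only values on the space.\<close>
  let ?\<psi> = "restrict \<phi> (topspace X)"
  have "sugeno X c \<phi> = sugeno X c ?\<psi>" for c by (rule sugeno_cong) simp
  then have "openin (capacity_space X) {c \<in> topspace (capacity_space X). a < sugeno X c \<phi>}" for a
    using openin_less_sugeno[OF restrict_unit_map[OF \<phi>]] by simp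
  then show ?thesis
    using openin_sugeno_less[OF X \<phi>] sugeno_nonneg[OF _ usc_on_continuous[OF \<phi>]] sugeno_le_1[of X _ \<phi>]
    unfolding unit_map_iff continuous_map_upper_lower_semicontinuous_lt
    by (auto simp: topspace_capacity_space)
qed

section \<open>Separation of capacities and the weak topology of the integrals\<close>

text \<open>By complete regularity \<open>F\<close> is the intersection of the sets where a
  continuous \<open>\<phi>\<close> equal to 1 on \<open>F\<close> reaches 1. Pointwise minima make
  this family directed, so if every member had capacity at least \<open>a\<close>, smoothness would
  give \<open>a \<le> c F\<close>.\<close>

lemma tau_capacity_less_superlevel:
  fixes X :: "'a topology"
  assumes X: "tychonoff_space X" and c: "c \<in> tau_capacities X" and F: "closedin X F" and less: "c F < a"
  obtains \<phi> :: "'a \<Rightarrow> real" where "continuous_map X (top_of_set {0..1}) \<phi>" "\<forall>x\<in>F. \<phi> x = 1"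
    "c {x \<in> topspace X. 1 \<le> \<phi> x} < a"
proof -
  define \<Phi> where "\<Phi> = {\<phi>. continuous_map X (top_of_set {0..1}) \<phi> \<and> (\<forall>x\<in>F. \<phi> x = (1::real))}"
  let ?L = "\<lambda>\<phi>. {x \<in> topspace X. 1 \<le> \<phi> x}"
  have "\<exists>\<phi>\<in>\<Phi>. c (?L \<phi>) < a"
  proof (rule ccontr)
    assume "\<not> (\<exists>\<phi>\<in>\<Phi>. c (?L \<phi>) < a)"
    then have ge: "a \<le> c (?L \<phi>)" if "\<phi> \<in> \<Phi>" for \<phi>
      using that by (meson not_le)
    have "a \<le> c F"
    proof (rule tau_capacity_directed[OF c, of "?L ` \<Phi>"])
      have "(\<lambda>_. 1) \<in> \<Phi>" by (simp add: \<Phi>_def)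
      then show "?L ` \<Phi> \<noteq> {}" by blast
      show "closedin X S" if "S \<in> ?L ` \<Phi>" for S
        using that usc_onD[OF usc_on_continuous] by (auto simp: \<Phi>_def)
      show "\<exists>R\<in>?L ` \<Phi>. R \<subseteq> S \<and> R \<subseteq> T" if ST: "S \<in> ?L ` \<Phi>" "T \<in> ?L ` \<Phi>" for S T
      proof -
        obtain \<phi> \<psi> where h: "\<phi> \<in> \<Phi>" "\<psi> \<in> \<Phi>" "S = ?L \<phi>" "T = ?L \<psi>" using ST by blast
        then have "(\<lambda>x. min (\<phi> x) (\<psi> x)) \<in> \<Phi>"
          by (auto simp: \<Phi>_def unit_map_iff intro!: continuous_map_real_min)
        then have "?L (\<lambda>x. min (\<phi> x) (\<psi> x)) \<in> ?L ` \<Phi>" by (rule imageI)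
        moreover have "?L (\<lambda>x. min (\<phi> x) (\<psi> x)) \<subseteq> S" "?L (\<lambda>x. min (\<phi> x) (\<psi> x)) \<subseteq> T"
          using h by auto
        ultimately show ?thesis by (intro bexI conjI)
      qed
      show "\<Inter>(?L ` \<Phi>) \<subseteq> F"
      proof
        fix x assume x: "x \<in> \<Inter>(?L ` \<Phi>)"
        show "x \<in> F"
        proof (rule ccontr)
          assume "x \<notin> F"
          moreover have "x \<in> topspace X" using x \<open>(\<lambda>_. 1) \<in> \<Phi>\<close> by auto
          ultimately obtain \<phi> :: "_ \<Rightarrow> real"
            where "continuous_map X (top_of_set {0..1}) \<phi>" "\<phi> x = 0" "\<phi> ` F \<subseteq> {1}"
            using X F unfolding tychonoff_space_def completely_regular_space_def by (meson DiffI)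
          then have "\<phi> \<in> \<Phi>" by (auto simp: \<Phi>_def)
          then show False using x \<open>\<phi> x = 0\<close> by force
        qed
      qed
    qed (use F ge in auto)
    then show False using less by simp
  qed
  then obtain \<phi> where "\<phi> \<in> \<Phi>" "c (?L \<phi>) < a" by blast
  then show thesis by (intro that[of \<phi>]) (auto simp: \<Phi>_def)
qed

text \<open>\<open>sugeno_less_iff\<close> uses one number both as level and as bound. Scaling by
  \<open>a\<close> moves level 1 of \<open>\<phi>\<close> to level \<open>a\<close>, which matches
  the two.\<close>

lemma sugeno_scaled_less_iff:
  assumes c: "c \<in> tau_capacities X" and \<phi>: "continuous_map X (top_of_set {0..1}) \<phi>"
    and a: "0 < a" "a \<le> 1"
  shows "sugeno X c (\<lambda>x. a * \<phi> x) < a \<longleftrightarrow> c {x \<in> topspace X. 1 \<le> \<phi> x} < a"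
    and "continuous_map X (top_of_set {0..1}) (\<lambda>x. a * \<phi> x)"
proof -
  show cont: "continuous_map X (top_of_set {0..1}) (\<lambda>x. a * \<phi> x)"
    using \<phi> a by (auto simp: unit_map_iff mult_le_one intro: continuous_map_real_mult_left)
  have "(a \<le> a * \<phi> x) = (1 \<le> \<phi> x)" for x
    using a by simp
  then show "sugeno X c (\<lambda>x. a * \<phi> x) < a \<longleftrightarrow> c {x \<in> topspace X. 1 \<le> \<phi> x} < a"
    using sugeno_less_iff[OF c usc_on_continuous[OF cont], of a] a by simp
qed

lemma sugeno_separates:
  assumes X: "tychonoff_space X" and cd: "c \<in> tau_capacities X" "d \<in> tau_capacities X"
    and eq: "\<And>\<phi>. continuous_map X (top_of_set {0..1}) \<phi> \<Longrightarrow> sugeno X c \<phi> = sugeno X d \<phi>"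
  shows "c = d"
proof (rule tau_capacity_eqI[OF cd])
  \<comment> \<open>The claim is stated for arbitrary \<open>c\<close> and \<open>d\<close>, so that
    it can be applied in both directions.\<close>
  have less: "d F < a"
    if cd: "c \<in> tau_capacities X" "d \<in> tau_capacities X"
      and eq: "\<And>\<phi>. continuous_map X (top_of_set {0..1}) \<phi> \<Longrightarrow> sugeno X c \<phi> = sugeno X d \<phi>"
      and F: "closedin X F" and a: "0 < a" "a \<le> 1" "c F < a" for c d F a
  proof -
    obtain \<phi> :: "_ \<Rightarrow> real" where \<phi>: "continuous_map X (top_of_set {0..1}) \<phi>" "\<forall>x\<in>F. \<phi> x = 1"
      "c {x \<in> topspace X. 1 \<le> \<phi> x} < a"
      using tau_capacity_less_superlevel[OF X cd(1) F a(3)] by blast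
    have "d {x \<in> topspace X. 1 \<le> \<phi> x} < a"
      using \<phi> a cd eq sugeno_scaled_less_iff[OF _ \<phi>(1) a(1,2)] by metis
    moreover have "d F \<le> d {x \<in> topspace X. 1 \<le> \<phi> x}"
      using \<phi>(2) closedin_subset[OF F]
      by (intro tau_capacity_mono[OF cd(2) F usc_onD[OF usc_on_continuous[OF \<phi>(1)]]]) auto
    ultimately show ?thesis by simp
  qed
  show "a \<le> c F \<longleftrightarrow> a \<le> d F" if "closedin X F" "0 < a" "a \<le> 1" for F a
    using less[OF cd eq that] less[OF cd(2,1) eq[symmetric] that] by linarith
qed

text \<open>It suffices that preimages of both kinds of subbasic sets are open. Around each point a
  set cut out by a single integral fits inside: for the first kind the integrand is a scaled
  function from \<open>tau_capacity_less_superlevel\<close>, for the second a Urysohn function on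
  the compactification.\<close>

lemma continuous_map_into_capacity_space:
  fixes X :: "'a topology" and Z :: "'z topology"
  assumes X: "tychonoff_space X" and g: "\<And>z. z \<in> topspace Z \<Longrightarrow> g z \<in> tau_capacities X"
    and cont: "\<And>\<phi>. continuous_map X (top_of_set {0..1}) \<phi> \<Longrightarrow>
      continuous_map Z euclideanreal (\<lambda>z. sugeno X (g z) \<phi>)"
  shows "continuous_map Z (capacity_space X) g"
  unfolding capacity_space_def
proof (rule continuous_map_pullback')
  let ?K = "stone_cech X" and ?e = "stone_cech_embed X"
  let ?h = "capacity_embed X \<circ> g"
  show "topspace Z \<subseteq> g -` tau_capacities X" using g by blast
  have h: "?h z \<in> compact_capacities ?K" if "z \<in> topspace Z" for z
    using capacity_embed_in[OF g[OF that]] by simp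
  have less: "openin Z {z \<in> topspace Z. sugeno X (g z) \<phi> < a}"
    and greater: "openin Z {z \<in> topspace Z. a < sugeno X (g z) \<phi>}"
    if "continuous_map X (top_of_set {0..1}) \<phi>" for \<phi> a
    using cont[OF that] unfolding continuous_map_upper_lower_semicontinuous_lt by blast+
  have sub1: "openin Z {z \<in> topspace Z. ?h z F < a}" if F: "closedin ?K F" for F a
  proof (subst openin_subopen, intro ballI)
    fix z assume "z \<in> {z \<in> topspace Z. ?h z F < a}"
    then have z: "z \<in> topspace Z" "?h z F < a" by auto
    let ?T = "{x \<in> topspace X. ?e x \<in> F}"
    have T: "closedin X ?T" by (rule closedin_preimage_stone_cech[OF F])
    have hT: "?h w F = g w ?T" for w using F by (simp add: capacity_embed_apply)
    show "\<exists>V. openin Z V \<and> z \<in> V \<and> V \<subseteq> {z \<in> topspace Z. ?h z F < a}"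
    proof (cases "a \<le> 1")
      case False
      have "g w ?T < a" if "w \<in> topspace Z" for w
        using tau_capacity_range(2)[OF g[OF that] T] False by linarith
      then show ?thesis using z(1) hT by (intro exI[of _ "topspace Z"]) auto
    next
      case True
      \<comment> \<open>Positivity is required for scaling by \<open>a\<close>.\<close>
      have "0 < a" using z hT tau_capacity_range(1)[OF g[OF z(1)] T] by simp
      have "g z ?T < a" using z(2) hT by simp
      then obtain \<phi> :: "_ \<Rightarrow> real"
        where \<phi>: "continuous_map X (top_of_set {0..1}) \<phi>" "\<forall>x\<in>?T. \<phi> x = 1"
        "g z {x \<in> topspace X. 1 \<le> \<phi> x} < a"
        by (rule tau_capacity_less_superlevel[OF X g[OF z(1)] T])
      note sc = sugeno_scaled_less_iff[OF _ \<phi>(1) \<open>0 < a\<close> True]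
      let ?V = "{w \<in> topspace Z. sugeno X (g w) (\<lambda>x. a * \<phi> x) < a}"
      have "openin Z ?V" by (rule less[OF sc(2)[OF g[OF z(1)]]])
      moreover have "z \<in> ?V" using z(1) sc(1)[OF g[OF z(1)]] \<phi>(3) by simp
      moreover have "g w ?T < a" if "w \<in> ?V" for w
      proof -
        have w: "w \<in> topspace Z" using that by simp
        have "g w ?T \<le> g w {x \<in> topspace X. 1 \<le> \<phi> x}"
          using \<phi>(2)
          by (intro tau_capacity_mono[OF g[OF w] T usc_onD[OF usc_on_continuous[OF \<phi>(1)]]]) auto
        then show ?thesis using sc(1)[OF g[OF w]] that by simp
      qed
      ultimately show ?thesis using hT by (intro exI[of _ ?V]) auto
    qed
  qed
  have sub2: "openin Z {z \<in> topspace Z. \<exists>F. compactin ?K F \<and> F \<subseteq> U \<and> a < ?h z F}"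
    (is "openin Z ?W") if U: "openin ?K U" for U a
  proof (subst openin_subopen, intro ballI)
    fix z assume "z \<in> ?W"
    then obtain F where z: "z \<in> topspace Z" and F: "compactin ?K F" "F \<subseteq> U" "a < ?h z F" by auto
    have cl: "closedin ?K F"
      using F(1) Hausdorff_space_stone_cech by (rule compactin_imp_closedin[rotated])
    show "\<exists>V. openin Z V \<and> z \<in> V \<and> V \<subseteq> ?W"
    proof (cases "0 \<le> a")
      case False
      \<comment> \<open>For negative \<open>a\<close> the empty compact set is a witness at every
        point.\<close>
      have "a < ?h w {}" if "w \<in> topspace Z" for w
        using tau_capacity_empty[OF g[OF that]] False by (simp add: capacity_embed_apply)
      then show ?thesis using z by (intro exI[of _ "topspace Z"]) (auto intro!: exI[of _ "{}"])
    next
      case True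
      have "normal_space ?K"
        by (simp add: compact_Hausdorff_or_regular_imp_normal_space compact_space_stone_cech
            Hausdorff_space_stone_cech)
      moreover have "closedin ?K (topspace ?K - U)" "disjnt (topspace ?K - U) F"
        using U F(2) by (auto simp: disjnt_def)
      ultimately obtain q :: "_ \<Rightarrow> real"
        where q: "continuous_map ?K (top_of_set {0..1}) q" "q ` (topspace ?K - U) \<subseteq> {0}" "q ` F \<subseteq> {1}"
        using cl unfolding normal_space_iff_Urysohn by metis
      define \<psi> where "\<psi> = q \<circ> ?e"
      have \<psi>: "continuous_map X (top_of_set {0..1}) \<psi>"
        unfolding \<psi>_def using continuous_map_stone_cech_embed q(1) by (rule continuous_map_compose)
      have eK: "?e x \<in> topspace ?K" if "x \<in> topspace X" for x
        using that continuous_map_stone_cech_embed[of X] by (auto simp: continuous_map_def)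
      let ?V = "{w \<in> topspace Z. a < sugeno X (g w) \<psi>}"
      have "openin Z ?V" by (rule greater[OF \<psi>])
      moreover have "z \<in> ?V"
      proof -
        let ?T = "{x \<in> topspace X. ?e x \<in> F}"
        have T: "closedin X ?T" by (rule closedin_preimage_stone_cech[OF cl])
        have "a < g z ?T" using F(3) cl by (simp add: capacity_embed_apply)
        also have "\<dots> \<le> g z {x \<in> topspace X. 1 \<le> \<psi> x}"
          using q(3)
          by (intro tau_capacity_mono[OF g[OF z] T usc_onD[OF usc_on_continuous[OF \<psi>]]])
            (auto simp: \<psi>_def image_subset_iff)
        finally have "a < g z {x \<in> topspace X. 1 \<le> \<psi> x}" .
        \<comment> \<open>Level 1 can witness the strict inequality only if it lies above
          \<open>a\<close>.\<close>
        moreover from this have "a < 1"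
          using tau_capacity_range(2)[OF g[OF z] usc_onD[OF usc_on_continuous[OF \<psi>], of 1]] by simp
        ultimately show ?thesis using z by (auto simp: less_sugeno_iff intro!: bexI[of _ 1])
      qed
      moreover have "?V \<subseteq> ?W"
      proof
        fix w assume "w \<in> ?V"
        then obtain t where w: "w \<in> topspace Z" and t: "a < t" "a < g w {x \<in> topspace X. t \<le> \<psi> x}"
          by (auto simp: less_sugeno_iff)
        let ?F = "{y \<in> topspace ?K. t \<le> q y}"
        have "closedin ?K ?F" by (rule usc_onD[OF usc_on_continuous[OF q(1)]])
        \<comment> \<open>The level \<open>t\<close> is positive because \<open>t > a\<close> and
          \<open>a \<ge> 0\<close>, while \<open>q\<close> vanishes off \<open>U\<close>.\<close>
        moreover have "?F \<subseteq> U" using q(2) t(1) True by force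
        moreover have "{x \<in> topspace X. ?e x \<in> ?F} = {x \<in> topspace X. t \<le> \<psi> x}"
          using eK by (auto simp: \<psi>_def)
        ultimately have "compactin ?K ?F" "?F \<subseteq> U" "a < ?h w ?F"
          using t(2) closedin_compact_space[OF compact_space_stone_cech] by (auto simp: capacity_embed_apply)
        then show "w \<in> ?W" using w by blast
      qed
      ultimately show ?thesis by blast
    qed
  qed
  show "continuous_map Z (compact_capacity_space ?K) ?h"
    unfolding compact_capacity_space_def
  proof (rule continuous_on_generated_topo)
    fix V assume "V \<in> {{c \<in> compact_capacities ?K. c F < a} | F a. closedin ?K F} \<union>
      {{c \<in> compact_capacities ?K. \<exists>F. compactin ?K F \<and> F \<subseteq> U \<and> c F > a} | U a. openin ?K U}"
    then consider F a where "closedin ?K F" "V = {c \<in> compact_capacities ?K. c F < a}"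
      | U a where "openin ?K U" "V = {c \<in> compact_capacities ?K. \<exists>F. compactin ?K F \<and> F \<subseteq> U \<and> c F > a}"
      by blast
    then show "openin Z (?h -` V \<inter> topspace Z)"
    proof cases
      case 1
      then have "?h -` V \<inter> topspace Z = {z \<in> topspace Z. ?h z F < a}" using h by auto
      then show ?thesis using sub1[OF 1(1)] by simp
    next
      case 2
      then have "?h -` V \<inter> topspace Z = {z \<in> topspace Z. \<exists>F. compactin ?K F \<and> F \<subseteq> U \<and> a < ?h z F}"
        using h by auto
      then show ?thesis using sub2[OF 2(1)] by simp
    qed
  next
    \<comment> \<open>The union of the subbase is the underlying set of the generated topology,
      namely \<open>compact_capacities ?K\<close>.\<close>
    show "?h ` topspace Z \<subseteq> \<Union>({{c \<in> compact_capacities ?K. c F < a} | F a. closedin ?K F} \<union>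
      {{c \<in> compact_capacities ?K. \<exists>F. compactin ?K F \<and> F \<subseteq> U \<and> c F > a} | U a. openin ?K U})"
      using h topspace_compact_capacity_space[of ?K]
      unfolding compact_capacity_space_def topology_generated_by_topspace by blast
  qed
qed

text \<open>The tuple \<open>j\<close> of all integrals maps into a cube and is injective because
  integrals separate capacities. Its inverse on the image is continuous since the integrals of the
  inverse are coordinate projections. Subspaces of a cube are Tychonoff.\<close>

lemma tychonoff_capacity_space:
  fixes X :: "'a topology"
  assumes X: "tychonoff_space X"
  shows "tychonoff_space (capacity_space X)"
proof -
  let ?M = "capacity_space X"
  let ?P = "product_topology (\<lambda>_. top_of_set {0..1::real}) (unit_maps X)"
  define j where "j c = (\<lambda>\<phi>\<in>unit_maps X. sugeno X c \<phi>)" for c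
  have um: "continuous_map X (top_of_set {0..1}) \<phi>" if "\<phi> \<in> unit_maps X" for \<phi>
    using that by (simp add: unit_maps_def)
  have j: "continuous_map ?M ?P j"
    unfolding continuous_map_componentwise
    by (auto simp: j_def continuous_map_sugeno[OF X um])
  have j_sugeno: "j c (restrict \<phi> (topspace X)) = sugeno X c \<phi>"
    if "continuous_map X (top_of_set {0..1}) \<phi>" for c \<phi>
    using restrict_unit_map[OF that] by (simp add: j_def cong: sugeno_cong)
  have inj: "inj_on j (topspace ?M)"
  proof (rule inj_onI)
    fix c d assume "c \<in> topspace ?M" "d \<in> topspace ?M" "j c = j d"
    then show "c = d"
      using j_sugeno by (intro sugeno_separates[OF X]) (metis topspace_capacity_space)+
  qed
  let ?S = "subtopology ?P (j ` topspace ?M)"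
  let ?i = "inv_into (topspace ?M) j"
  have topS: "topspace ?S = j ` topspace ?M"
    using continuous_map_image_subset_topspace[OF j] by auto
  have ij: "?i (j c) = c" if "c \<in> topspace ?M" for c
    using inj that by simp
  have i: "continuous_map ?S ?M ?i"
  proof (rule continuous_map_into_capacity_space[OF X])
    show "?i z \<in> tau_capacities X" if "z \<in> topspace ?S" for z
      using that ij unfolding topS by (auto simp: topspace_capacity_space)
    show "continuous_map ?S euclideanreal (\<lambda>z. sugeno X (?i z) \<phi>)"
      if \<phi>: "continuous_map X (top_of_set {0..1}) \<phi>" for \<phi>
    proof (rule continuous_map_eq)
      show "continuous_map ?S euclideanreal (\<lambda>z. z (restrict \<phi> (topspace X)))"
        using continuous_map_product_projection[OF restrict_unit_map[OF \<phi>], of "\<lambda>_. top_of_set {0..1::real}"]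
        by (intro continuous_map_from_subtopology) (simp add: continuous_map_in_subtopology)
      show "z (restrict \<phi> (topspace X)) = sugeno X (?i z) \<phi>" if "z \<in> topspace ?S" for z
        using that j_sugeno[OF \<phi>] ij unfolding topS by auto
    qed
  qed
  have "homeomorphic_maps ?M ?S j ?i"
    unfolding homeomorphic_maps_def topS
    using i j ij by (auto simp: continuous_map_in_subtopology)
  then have hom: "?M homeomorphic_space ?S"
    unfolding homeomorphic_space_def by blast
  have H: "Hausdorff_space ?P" and "compact_space ?P"
    by (simp_all add: Hausdorff_space_product_topology Hausdorff_space_subtopology
        compact_space_product_topology compact_space_subtopology)
  then have "completely_regular_space ?P"
    by (simp add: compact_Hausdorff_or_regular_imp_normal_space normal_imp_completely_regular_space)
  then show ?thesis
    using H homeomorphic_completely_regular_space[OF hom] homeomorphic_Hausdorff_space[OF hom]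
    by (simp add: tychonoff_space_def completely_regular_space_subtopology Hausdorff_space_subtopology)
qed

section \<open>The action on continuous maps\<close>

lemma capacity_map_apply:
  "closedin Y F \<Longrightarrow> capacity_map X Y f c F = c {x \<in> topspace X. f x \<in> F}"
  by (simp add: capacity_map_def)

text \<open>Taking preimages preserves closedness, inclusions and intersections, so a directed
  family in \<open>Y\<close> pulls back to one in \<open>X\<close>.\<close>

lemma capacity_map_in:
  fixes X :: "'a topology" and Y :: "'b topology"
  assumes f: "continuous_map X Y f" and c: "c \<in> tau_capacities X"
  shows "capacity_map X Y f c \<in> tau_capacities Y"
proof -
  let ?p = "\<lambda>F. {x \<in> topspace X. f x \<in> F}"
  have cl: "closedin X (?p F)" if "closedin Y F" for F
    using f that by (rule closedin_continuous_map_preimage)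
  have top: "?p (topspace Y) = topspace X"
    using continuous_map_image_subset_topspace[OF f] by auto
  show ?thesis
  proof (rule tau_capacityI)
    show "capacity_map X Y f c \<in> extensional (Collect (closedin Y))" by (simp add: capacity_map_def)
    show "capacity_map X Y f c (topspace Y) = 1"
      using top tau_capacity_topspace[OF c] by (simp add: capacity_map_apply)
    show "capacity_map X Y f c F \<le> capacity_map X Y f c G"
      if FG: "closedin Y F" "closedin Y G" "F \<subseteq> G" for F G
    proof -
      have "c (?p F) \<le> c (?p G)" using FG by (intro tau_capacity_mono[OF c] cl) auto
      then show ?thesis using FG by (simp add: capacity_map_apply)
    qed
    show "a \<le> capacity_map X Y f c G"
      if \<F>: "\<F> \<noteq> {}" "\<And>S. S \<in> \<F> \<Longrightarrow> closedin Y S"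
        "\<And>S T. S \<in> \<F> \<Longrightarrow> T \<in> \<F> \<Longrightarrow> \<exists>R\<in>\<F>. R \<subseteq> S \<and> R \<subseteq> T"
        and G: "closedin Y G" "\<Inter>\<F> \<subseteq> G"
        and ge: "\<And>S. S \<in> \<F> \<Longrightarrow> a \<le> capacity_map X Y f c S" for \<F> G a
    proof -
      have "a \<le> c (?p G)"
      proof (rule tau_capacity_directed[OF c, of "?p ` \<F>"])
        show "\<exists>R\<in>?p ` \<F>. R \<subseteq> S \<and> R \<subseteq> T" if ST: "S \<in> ?p ` \<F>" "T \<in> ?p ` \<F>" for S T
        proof -
          obtain S' T' where "S' \<in> \<F>" "T' \<in> \<F>" "S = ?p S'" "T = ?p T'" using ST by blast
          moreover from this obtain R where "R \<in> \<F>" "R \<subseteq> S'" "R \<subseteq> T'" using \<F>(3) by blast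
          ultimately have "?p R \<in> ?p ` \<F>" "?p R \<subseteq> S" "?p R \<subseteq> T" by auto
          then show ?thesis by blast
        qed
        show "a \<le> c S" if "S \<in> ?p ` \<F>" for S
          using that ge \<F>(2) by (auto simp: capacity_map_apply)
      qed (use \<F>(1,2) G cl in auto)
      then show ?thesis using G by (simp add: capacity_map_apply)
    qed
  qed (use tau_capacity_range[OF c] tau_capacity_empty[OF c] cl in \<open>auto simp: capacity_map_apply\<close>)
qed

lemma sugeno_capacity_map:
  assumes f: "continuous_map X Y f" and \<phi>: "usc_on Y \<phi>"
  shows "sugeno Y (capacity_map X Y f c) \<phi> = sugeno X c (\<phi> \<circ> f)"
proof -
  have "{x \<in> topspace X. f x \<in> {y \<in> topspace Y. t \<le> \<phi> y}} = {x \<in> topspace X. t \<le> (\<phi> \<circ> f) x}" for t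
    using continuous_map_image_subset_topspace[OF f] by auto
  then show ?thesis
    by (simp add: sugeno_def capacity_map_apply[OF usc_onD[OF \<phi>]])
qed

lemma continuous_map_capacity_map:
  assumes X: "tychonoff_space X" and Y: "tychonoff_space Y" and f: "continuous_map X Y f"
  shows "continuous_map (capacity_space X) (capacity_space Y) (capacity_map X Y f)"
proof (rule continuous_map_into_capacity_space[OF Y])
  show "capacity_map X Y f c \<in> tau_capacities Y" if "c \<in> topspace (capacity_space X)" for c
    using capacity_map_in[OF f] that by (simp add: topspace_capacity_space)
  show "continuous_map (capacity_space X) euclideanreal (\<lambda>c. sugeno Y (capacity_map X Y f c) \<phi>)"
    if \<phi>: "continuous_map Y (top_of_set {0..1}) \<phi>" for \<phi>
    using continuous_map_sugeno[OF X continuous_map_compose[OF f \<phi>]]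
    unfolding sugeno_capacity_map[OF f usc_on_continuous[OF \<phi>]]
    by (simp add: unit_map_iff)
qed

section \<open>The unit\<close>

lemma capacity_unit_apply: "closedin X F \<Longrightarrow> capacity_unit X x F = (if x \<in> F then 1 else 0)"
  by (simp add: capacity_unit_def)

text \<open>If \<open>x\<close> lies outside \<open>G\<close>, some member of the family misses
  \<open>x\<close>; its value is 0, which forces \<open>a \<le> 0\<close>.\<close>

lemma capacity_unit_in:
  assumes "x \<in> topspace X"
  shows "capacity_unit X x \<in> tau_capacities X"
proof (rule tau_capacityI)
  show "a \<le> capacity_unit X x G"
    if \<F>: "\<And>S. S \<in> \<F> \<Longrightarrow> closedin X S" and G: "closedin X G" "\<Inter>\<F> \<subseteq> G"
      and a: "0 \<le> a" "a \<le> 1" and ge: "\<And>S. S \<in> \<F> \<Longrightarrow> a \<le> capacity_unit X x S" for \<F> G a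
  proof (cases "x \<in> G")
    case False
    then obtain S where "S \<in> \<F>" "x \<notin> S" using G(2) by blast
    then have "a \<le> 0" using ge[of S] \<F>[of S] by (simp add: capacity_unit_apply)
    then show ?thesis using G False by (simp add: capacity_unit_apply)
  qed (use G a in \<open>simp add: capacity_unit_apply\<close>)
  show "capacity_unit X x F \<le> capacity_unit X x G"
    if "closedin X F" "closedin X G" "F \<subseteq> G" for F G
    using that by (auto simp: capacity_unit_apply)
qed (use assms in \<open>auto simp: capacity_unit_apply\<close>, simp add: capacity_unit_def)

text \<open>This fails at \<open>a = 0\<close> for points outside \<open>F\<close>; the equality
  criteria test only positive levels.\<close>

lemma le_capacity_unit_iff:
  assumes "closedin X F" "0 < a" "a \<le> 1"
  shows "a \<le> capacity_unit X x F \<longleftrightarrow> x \<in> F"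
  using assms by (simp add: capacity_unit_apply)

lemma sugeno_capacity_unit:
  assumes x: "x \<in> topspace X" and \<phi>: "continuous_map X (top_of_set {0..1}) \<phi>"
  shows "sugeno X (capacity_unit X x) \<phi> = \<phi> x"
proof (rule unit_eq_thresholdI)
  note usc = usc_on_continuous[OF \<phi>] and c = capacity_unit_in[OF x]
  show "a \<le> sugeno X (capacity_unit X x) \<phi> \<longleftrightarrow> a \<le> \<phi> x" if a: "0 < a" "a \<le> 1" for a
    using a x by (simp add: le_sugeno_iff[OF c usc] le_capacity_unit_iff[OF usc_onD[OF usc]])
  show "0 \<le> sugeno X (capacity_unit X x) \<phi>" by (rule sugeno_nonneg[OF c usc])
qed (use unit_map_range[OF \<phi> x] sugeno_le_1 in auto)

lemma continuous_map_capacity_unit: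
  assumes X: "tychonoff_space X"
  shows "continuous_map X (capacity_space X) (capacity_unit X)"
proof (rule continuous_map_into_capacity_space[OF X])
  show "continuous_map X euclideanreal (\<lambda>x. sugeno X (capacity_unit X x) \<phi>)"
    if \<phi>: "continuous_map X (top_of_set {0..1}) \<phi>" for \<phi>
    by (rule continuous_map_eq[of _ _ \<phi>])
      (use \<phi> sugeno_capacity_unit[OF _ \<phi>] in \<open>auto simp: unit_map_iff\<close>)
qed (rule capacity_unit_in)

section \<open>The multiplication\<close>

lemma capacity_mult_apply:
  "closedin X F \<Longrightarrow> capacity_mult X C F = sugeno (capacity_space X) C (\<lambda>c. c F)"
  by (simp add: capacity_mult_def sugeno_def)

text \<open>Evaluation at \<open>F\<close> is upper semicontinuous, so \<open>le_sugeno_iff\<close>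
  removes the supremum. Identities for the multiplication thereby become comparisons of closed sets
  of capacities.\<close>

lemma le_capacity_mult_iff:
  assumes X: "tychonoff_space X" and C: "C \<in> tau_capacities (capacity_space X)"
    and F: "closedin X F" and a: "0 \<le> a" "a \<le> 1"
  shows "a \<le> capacity_mult X C F \<longleftrightarrow> a \<le> C {c \<in> topspace (capacity_space X). a \<le> c F}"
  using le_sugeno_iff[OF C usc_on_eval[OF X F] a] by (simp add: capacity_mult_apply[OF F])

text \<open>At a fixed level \<open>a\<close>, a directed family of closed sets is sent to the
  directed family of sets \<open>?L a S\<close>. Smoothness is then used twice: for each single
  capacity to bound the intersection, and for \<open>C\<close> to pass to it.\<close>

lemma capacity_mult_in:
  fixes X :: "'a topology"
  assumes X: "tychonoff_space X" and C: "C \<in> tau_capacities (capacity_space X)"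
  shows "capacity_mult X C \<in> tau_capacities X"
proof -
  let ?M = "capacity_space X"
  let ?L = "\<lambda>a F. {c \<in> topspace ?M. a \<le> c F}"
  note cl = closedin_capacity_ge[OF X]
  note le = le_capacity_mult_iff[OF X C]
  have range: "0 \<le> capacity_mult X C F \<and> capacity_mult X C F \<le> 1" if "closedin X F" for F
    using sugeno_nonneg[OF C usc_on_eval[OF X that]] sugeno_le_1
    by (simp add: capacity_mult_apply[OF that])
  have smooth: "a \<le> capacity_mult X C G"
    if \<F>: "\<F> \<noteq> {}" "\<And>S. S \<in> \<F> \<Longrightarrow> closedin X S"
      "\<And>S T. S \<in> \<F> \<Longrightarrow> T \<in> \<F> \<Longrightarrow> \<exists>R\<in>\<F>. R \<subseteq> S \<and> R \<subseteq> T"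
      and G: "closedin X G" "\<Inter>\<F> \<subseteq> G" and a: "0 \<le> a" "a \<le> 1"
      and ge: "\<And>S. S \<in> \<F> \<Longrightarrow> a \<le> capacity_mult X C S" for \<F> G a
  proof -
    have mono: "?L a R \<subseteq> ?L a S" if "R \<in> \<F>" "S \<in> \<F>" "R \<subseteq> S" for R S
      using that \<F>(2) tau_capacity_mono[of _ X R S] by (force simp: topspace_capacity_space)
    have "a \<le> C (?L a G)"
    proof (rule tau_capacity_directed[OF C, of "?L a ` \<F>"])
      show "\<exists>R\<in>?L a ` \<F>. R \<subseteq> S \<and> R \<subseteq> T" if ST: "S \<in> ?L a ` \<F>" "T \<in> ?L a ` \<F>" for S T
      proof -
        obtain S' T' where ST': "S' \<in> \<F>" "T' \<in> \<F>" "S = ?L a S'" "T = ?L a T'" using ST by blast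
        then obtain R where R: "R \<in> \<F>" "R \<subseteq> S'" "R \<subseteq> T'" using \<F>(3) by blast
        have "?L a R \<subseteq> S" "?L a R \<subseteq> T" unfolding ST' using mono R ST'(1,2) by blast+
        then show ?thesis using R(1) by blast
      qed
      show "\<Inter>(?L a ` \<F>) \<subseteq> ?L a G"
      proof
        fix c assume c: "c \<in> \<Inter>(?L a ` \<F>)"
        then have cM: "c \<in> topspace ?M" using \<F>(1) by blast
        \<comment> \<open>This is smoothness of the single capacity \<open>c\<close>, applied to the
          original family.\<close>
        have "a \<le> c G"
        proof (rule tau_capacity_directed[OF _ \<F> G])
          show "c \<in> tau_capacities X" using cM by (simp add: topspace_capacity_space)
        qed (use c in auto)
        then show "c \<in> ?L a G" using cM by simp
      qed
      show "a \<le> C S" if "S \<in> ?L a ` \<F>" for S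
        using that ge le[OF \<F>(2) a] by blast
    qed (use \<F>(1,2) G(1) cl in auto)
    then show ?thesis using le[OF G(1) a] by simp
  qed
  \<comment> \<open>Every capacity vanishes on the empty set, so no capacity reaches a positive
    level there.\<close>
  have "C (?L t {}) = 0" if "0 < t" for t
  proof -
    have "?L t {} = {}" using that by (auto simp: topspace_capacity_space tau_capacity_empty)
    then show ?thesis using tau_capacity_empty[OF C] by (simp only:)
  qed
  then have "\<not> 0 < capacity_mult X C {}"
    by (auto simp: less_sugeno_iff capacity_mult_apply)
  then have empty: "capacity_mult X C {} = 0" using range[of "{}"] by simp
  have "?L 1 (topspace X) = topspace ?M"
    by (auto simp: topspace_capacity_space tau_capacity_topspace)
  then have "1 \<le> capacity_mult X C (topspace X)"
    using tau_capacity_topspace[OF C] le[of "topspace X" 1] by simp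
  then have top: "capacity_mult X C (topspace X) = 1" using range[of "topspace X"] by simp
  show ?thesis
  proof (rule tau_capacityI[OF _ range empty top _ smooth])
    show "capacity_mult X C \<in> extensional (Collect (closedin X))" by (simp add: capacity_mult_def)
    \<comment> \<open>Monotonicity is smoothness for the one-element family \<open>{F}\<close> at
      the level of its own value.\<close>
    show "capacity_mult X C F \<le> capacity_mult X C G"
      if "closedin X F" "closedin X G" "F \<subseteq> G" for F G
      using smooth[of "{F}" G "capacity_mult X C F"] range that by auto
  qed
qed

text \<open>By \<open>le_sugeno_iff\<close>, the superlevel set at \<open>a\<close> of the integral
  of \<open>\<phi>\<close> consists of the capacities with value at least \<open>a\<close> on the
  superlevel set of \<open>\<phi>\<close>. Both thresholds thus concern the value of
  \<open>C\<close> on this set.\<close>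

lemma sugeno_capacity_mult:
  assumes X: "tychonoff_space X" and C: "C \<in> tau_capacities (capacity_space X)"
    and \<phi>: "continuous_map X (top_of_set {0..1}) \<phi>"
  shows "sugeno X (capacity_mult X C) \<phi> = sugeno (capacity_space X) C (\<lambda>c. sugeno X c \<phi>)"
proof (rule unit_eq_thresholdI)
  let ?M = "capacity_space X"
  note usc = usc_on_continuous[OF \<phi>] and usc' = usc_on_continuous[OF continuous_map_sugeno[OF X \<phi>]]
  show "a \<le> sugeno X (capacity_mult X C) \<phi> \<longleftrightarrow> a \<le> sugeno ?M C (\<lambda>c. sugeno X c \<phi>)"
    if a: "0 < a" "a \<le> 1" for a
  proof -
    have a': "0 \<le> a" using a by simp
    have "{c \<in> topspace ?M. a \<le> sugeno X c \<phi>} = {c \<in> topspace ?M. a \<le> c {x \<in> topspace X. a \<le> \<phi> x}}"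
      using le_sugeno_iff[OF _ usc a' a(2)] by (auto simp: topspace_capacity_space)
    then show ?thesis
      by (simp add: le_sugeno_iff[OF capacity_mult_in[OF X C] usc a' a(2)] le_sugeno_iff[OF C usc' a' a(2)]
          le_capacity_mult_iff[OF X C usc_onD[OF usc] a' a(2)])
  qed
qed (use sugeno_nonneg[OF capacity_mult_in[OF X C] usc_on_continuous[OF \<phi>]]
    sugeno_nonneg[OF C usc_on_continuous[OF continuous_map_sugeno[OF X \<phi>]]] sugeno_le_1 in auto)

lemma continuous_map_capacity_mult:
  assumes X: "tychonoff_space X"
  shows "continuous_map (capacity_space (capacity_space X)) (capacity_space X) (capacity_mult X)"
proof (rule continuous_map_into_capacity_space[OF X])
  show "capacity_mult X C \<in> tau_capacities X" if "C \<in> topspace (capacity_space (capacity_space X))" for C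
    using capacity_mult_in[OF X] that by (simp add: topspace_capacity_space)
  show "continuous_map (capacity_space (capacity_space X)) euclideanreal (\<lambda>C. sugeno X (capacity_mult X C) \<phi>)"
    if \<phi>: "continuous_map X (top_of_set {0..1}) \<phi>" for \<phi>
  proof (rule continuous_map_eq)
    show "continuous_map (capacity_space (capacity_space X)) euclideanreal
        (\<lambda>C. sugeno (capacity_space X) C (\<lambda>c. sugeno X c \<phi>))"
      using continuous_map_sugeno[OF tychonoff_capacity_space[OF X] continuous_map_sugeno[OF X \<phi>]]
      by (simp add: unit_map_iff)
    show "sugeno (capacity_space X) C (\<lambda>c. sugeno X c \<phi>) = sugeno X (capacity_mult X C) \<phi>"
      if "C \<in> topspace (capacity_space (capacity_space X))" for C
      using sugeno_capacity_mult[OF X _ \<phi>] that by (simp add: topspace_capacity_space)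
  qed
qed

section \<open>Functoriality, naturality and the monad laws\<close>

lemma capacity_map_id:
  assumes c: "c \<in> tau_capacities X"
  shows "capacity_map X X id c = c"
proof (rule tau_capacity_eqI[OF capacity_map_in[OF continuous_map_id c] c])
  fix F and a :: real assume F: "closedin X F"
  then have "{x \<in> topspace X. id x \<in> F} = F" using closedin_subset[OF F] by auto
  then show "a \<le> capacity_map X X id c F \<longleftrightarrow> a \<le> c F" using F by (simp add: capacity_map_apply)
qed

text \<open>Preimages compose, and off the closed sets both sides are
  \<open>undefined\<close>.\<close>

lemma capacity_map_compose:
  assumes f: "continuous_map X Y f" and g: "continuous_map Y Z g"
  shows "capacity_map X Z (g \<circ> f) c = capacity_map Y Z g (capacity_map X Y f c)"
proof
  fix F
  show "capacity_map X Z (g \<circ> f) c F = capacity_map Y Z g (capacity_map X Y f c) F"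
  proof (cases "closedin Z F")
    case True
    have "{x \<in> topspace X. f x \<in> {y \<in> topspace Y. g y \<in> F}} = {x \<in> topspace X. (g \<circ> f) x \<in> F}"
      using continuous_map_image_subset_topspace[OF f] by auto
    then show ?thesis
      using True closedin_continuous_map_preimage[OF g True] by (simp add: capacity_map_apply)
  qed (simp add: capacity_map_def)
qed

lemma capacity_map_unit:
  assumes f: "continuous_map X Y f" and x: "x \<in> topspace X"
  shows "capacity_map X Y f (capacity_unit X x) = capacity_unit Y (f x)"
proof
  fix F
  show "capacity_map X Y f (capacity_unit X x) F = capacity_unit Y (f x) F"
    using closedin_continuous_map_preimage[OF f, of F] x
    by (cases "closedin Y F") (auto simp: capacity_map_def capacity_unit_def)
qed

text \<open>Pulling back the set of \<open>d\<close> with \<open>a \<le> d F\<close> along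
  \<open>capacity_map X Y f\<close> gives the set of \<open>c\<close> that reach \<open>a\<close> on
  the preimage of \<open>F\<close>. Both thresholds compare \<open>a\<close> with the value of
  \<open>C\<close> there.\<close>

lemma capacity_map_mult:
  fixes X :: "'a topology" and Y :: "'b topology"
  assumes X: "tychonoff_space X" and Y: "tychonoff_space Y" and f: "continuous_map X Y f"
    and C: "C \<in> tau_capacities (capacity_space X)"
  shows "capacity_map X Y f (capacity_mult X C) =
    capacity_mult Y (capacity_map (capacity_space X) (capacity_space Y) (capacity_map X Y f) C)"
    (is "_ = capacity_mult Y ?D")
proof (rule tau_capacity_eqI)
  let ?MX = "capacity_space X" and ?MY = "capacity_space Y"
  note Mf = continuous_map_capacity_map[OF X Y f]
  have D: "?D \<in> tau_capacities ?MY" by (rule capacity_map_in[OF Mf C])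
  show "capacity_map X Y f (capacity_mult X C) \<in> tau_capacities Y"
    by (rule capacity_map_in[OF f capacity_mult_in[OF X C]])
  show "capacity_mult Y ?D \<in> tau_capacities Y" by (rule capacity_mult_in[OF Y D])
  fix F and a :: real assume F: "closedin Y F" and a: "0 < a" "a \<le> 1"
  have F': "closedin X {x \<in> topspace X. f x \<in> F}"
    by (rule closedin_continuous_map_preimage[OF f F])
  have "{c \<in> topspace ?MX. capacity_map X Y f c \<in> {d \<in> topspace ?MY. a \<le> d F}} =
      {c \<in> topspace ?MX. a \<le> c {x \<in> topspace X. f x \<in> F}}"
    using capacity_map_in[OF f] F by (auto simp: capacity_map_apply topspace_capacity_space)
  then show "a \<le> capacity_map X Y f (capacity_mult X C) F \<longleftrightarrow> a \<le> capacity_mult Y ?D F"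
    using a by (simp add: le_capacity_mult_iff[OF Y D F] capacity_map_apply[OF F]
        le_capacity_mult_iff[OF X C F'] capacity_map_apply[OF closedin_capacity_ge[OF Y F]])
qed

text \<open>The unit at \<open>c\<close> tests whether \<open>c\<close> belongs to the set of
  capacities reaching \<open>a\<close> on \<open>F\<close>.\<close>

lemma capacity_mult_unit:
  assumes X: "tychonoff_space X" and c: "c \<in> tau_capacities X"
  shows "capacity_mult X (capacity_unit (capacity_space X) c) = c"
proof (rule tau_capacity_eqI[OF _ c])
  have cM: "c \<in> topspace (capacity_space X)" using c by (simp add: topspace_capacity_space)
  note C = capacity_unit_in[OF cM]
  show "capacity_mult X (capacity_unit (capacity_space X) c) \<in> tau_capacities X"
    by (rule capacity_mult_in[OF X C])
  show "a \<le> capacity_mult X (capacity_unit (capacity_space X) c) F \<longleftrightarrow> a \<le> c F"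
    if F: "closedin X F" and a: "0 < a" "a \<le> 1" for F a
    using a cM by (simp add: le_capacity_mult_iff[OF X C F]
        le_capacity_unit_iff[OF closedin_capacity_ge[OF X F]])
qed

text \<open>For positive \<open>a\<close>, the point capacities reaching \<open>a\<close> on
  \<open>F\<close> are exactly those at points of \<open>F\<close>.\<close>

lemma capacity_mult_map_unit:
  assumes X: "tychonoff_space X" and c: "c \<in> tau_capacities X"
  shows "capacity_mult X (capacity_map X (capacity_space X) (capacity_unit X) c) = c"
proof (rule tau_capacity_eqI[OF _ c])
  let ?M = "capacity_space X"
  note C = capacity_map_in[OF continuous_map_capacity_unit[OF X] c]
  show "capacity_mult X (capacity_map X ?M (capacity_unit X) c) \<in> tau_capacities X"
    by (rule capacity_mult_in[OF X C])
  show "a \<le> capacity_mult X (capacity_map X ?M (capacity_unit X) c) F \<longleftrightarrow> a \<le> c F"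
    if F: "closedin X F" and a: "0 < a" "a \<le> 1" for F a
  proof -
    have "{x \<in> topspace X. capacity_unit X x \<in> {d \<in> topspace ?M. a \<le> d F}} = F"
      using capacity_unit_in[of _ X] closedin_subset[OF F] le_capacity_unit_iff[OF F a]
      by (auto simp: topspace_capacity_space)
    then show ?thesis
      using a by (simp add: le_capacity_mult_iff[OF X C F]
          capacity_map_apply[OF closedin_capacity_ge[OF X F]])
  qed
qed

text \<open>With \<open>?L\<close> the set of capacities reaching \<open>a\<close> on
  \<open>F\<close>, the threshold rule shows that \<open>capacity_mult X B\<close> lies in
  \<open>?L\<close> iff \<open>a \<le> B ?L\<close>. Both sides then reach \<open>a\<close> iff
  \<open>D\<close> does on the set of these \<open>B\<close>.\<close>

lemma capacity_mult_assoc: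
  fixes X :: "'a topology"
  assumes X: "tychonoff_space X"
    and D: "D \<in> tau_capacities (capacity_space (capacity_space X))"
  shows "capacity_mult X (capacity_map (capacity_space (capacity_space X)) (capacity_space X)
           (capacity_mult X) D) = capacity_mult X (capacity_mult (capacity_space X) D)"
    (is "capacity_mult X ?C = capacity_mult X ?C'")
proof (rule tau_capacity_eqI)
  let ?M = "capacity_space X"
  note M = tychonoff_capacity_space[OF X]
  have C: "?C \<in> tau_capacities ?M" by (rule capacity_map_in[OF continuous_map_capacity_mult[OF X] D])
  have C': "?C' \<in> tau_capacities ?M" by (rule capacity_mult_in[OF M D])
  show "capacity_mult X ?C \<in> tau_capacities X" "capacity_mult X ?C' \<in> tau_capacities X"
    by (rule capacity_mult_in[OF X C] capacity_mult_in[OF X C'])+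
  fix F and a :: real assume F: "closedin X F" and a: "0 < a" "a \<le> 1"
  let ?L = "{c \<in> topspace ?M. a \<le> c F}"
  note L = closedin_capacity_ge[OF X F, of a]
  have "{B \<in> topspace (capacity_space ?M). capacity_mult X B \<in> ?L} =
      {B \<in> topspace (capacity_space ?M). a \<le> B ?L}"
    using capacity_mult_in[OF X] le_capacity_mult_iff[OF X _ F, of _ a] a
    by (auto simp: topspace_capacity_space)
  then show "a \<le> capacity_mult X ?C F \<longleftrightarrow> a \<le> capacity_mult X ?C' F"
    using a by (simp add: le_capacity_mult_iff[OF X C F] le_capacity_mult_iff[OF X C' F]
        capacity_map_apply[OF L] le_capacity_mult_iff[OF M D L])
qed

theorem theorem4p8:
  shows "
    \<comment> \<open>functor\<close>
    (\<forall>X :: 'a topology. tychonoff_space X \<longrightarrow> tychonoff_space (capacity_space X)) \<and>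
    (\<forall>(X :: 'a topology) (Y :: 'b topology) f.
       tychonoff_space X \<and> tychonoff_space Y \<and> continuous_map X Y f \<longrightarrow>
       continuous_map (capacity_space X) (capacity_space Y) (capacity_map X Y f)) \<and>
    (\<forall>X :: 'a topology. tychonoff_space X \<longrightarrow>
       (\<forall>c \<in> topspace (capacity_space X). capacity_map X X id c = c)) \<and>
    (\<forall>(X :: 'a topology) (Y :: 'b topology) (Z :: 'c topology) f g.
       tychonoff_space X \<and> tychonoff_space Y \<and> tychonoff_space Z \<and>
       continuous_map X Y f \<and> continuous_map Y Z g \<longrightarrow>
       (\<forall>c \<in> topspace (capacity_space X).
          capacity_map X Z (g \<circ> f) c = capacity_map Y Z g (capacity_map X Y f c))) \<and>
    \<comment> \<open>natural transformations\<close>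
    (\<forall>X :: 'a topology. tychonoff_space X \<longrightarrow>
       continuous_map X (capacity_space X) (capacity_unit X)) \<and>
    (\<forall>(X :: 'a topology) (Y :: 'b topology) f.
       tychonoff_space X \<and> tychonoff_space Y \<and> continuous_map X Y f \<longrightarrow>
       (\<forall>x \<in> topspace X. capacity_map X Y f (capacity_unit X x) = capacity_unit Y (f x))) \<and>
    (\<forall>X :: 'a topology. tychonoff_space X \<longrightarrow>
       continuous_map (capacity_space (capacity_space X)) (capacity_space X) (capacity_mult X)) \<and>
    (\<forall>(X :: 'a topology) (Y :: 'b topology) f.
       tychonoff_space X \<and> tychonoff_space Y \<and> continuous_map X Y f \<longrightarrow>
       (\<forall>C \<in> topspace (capacity_space (capacity_space X)).
          capacity_map X Y f (capacity_mult X C) =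
          capacity_mult Y (capacity_map (capacity_space X) (capacity_space Y) (capacity_map X Y f) C))) \<and>
    \<comment> \<open>monad laws\<close>
    (\<forall>X :: 'a topology. tychonoff_space X \<longrightarrow>
       (\<forall>c \<in> topspace (capacity_space X).
          capacity_mult X (capacity_unit (capacity_space X) c) = c \<and>
          capacity_mult X (capacity_map X (capacity_space X) (capacity_unit X) c) = c) \<and>
       (\<forall>D \<in> topspace (capacity_space (capacity_space (capacity_space X))).
          capacity_mult X (capacity_map (capacity_space (capacity_space X)) (capacity_space X)
                             (capacity_mult X) D) =
          capacity_mult X (capacity_mult (capacity_space X) D)))"
  \<comment> \<open>Points of capacity spaces become members of \<open>tau_capacities\<close>, the
    form in which the lemmas take them.\<close>
  unfolding topspace_capacity_space
  by (intro conjI allI impI ballI; (elim conjE)?)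
    (rule tychonoff_capacity_space continuous_map_capacity_map capacity_map_id capacity_map_compose
      continuous_map_capacity_unit capacity_map_unit continuous_map_capacity_mult capacity_map_mult
      capacity_mult_unit capacity_mult_map_unit capacity_mult_assoc; assumption)+

end
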